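(* Let $G$ be a finite group, $T_0,T_1\subseteq G$, and let $X=BD(G,T_0,T_1)$ be a strongly connected Bi-Cayley digraph which is neither a directed cycle nor a symmetric cycle. Then $X$ is not super-$\lambda$ if and only if $X$ satisfies one of the following conditions: (1) there exist a subgroup $H\le G$ and three pairwise distinct elements $t_0,t_0',t_0''\in T_0$ such that either (a) $|H|=\delta(X)$, $T_1^{-1}t_0\subseteq H$, $t_0^{-1}(T_0\setminus\{t_0'\})\subseteq H$ and $t_0^{-1}t_0'\notin H$; or (b) $|H|=\delta(X)/2$, $T_1^{-1}t_0\subseteq H$, $t_0^{-1}(T_0\setminus\{t_0',t_0''\})\subseteq H$, $t_0^{-1}t_0'\notin H$ and $t_0^{-1}t_0''\notin H$; (2) there exist a subgroup $H\le G$, two distinct elements $t_1,t_1'\in T_1$ and an element $t_0\in T_0$ such that either (a) $|H|=\delta(X)$, $t_0^{-1}T_0\subseteq H$, $(T_1\setminus\{t_1'\})^{-1}t_0\subseteq H$ and $t_1'^{-1}t_0\notin H$; or (b) $|H|=\delta(X)/2$, $t_0^{-1}T_0\subseteq H$, $(T_1\setminus\{t_1,t_1'\})^{-1}t_0\subseteq H$, $t_1^{-1}t_0\notin H$ and $t_1'^{-1}t_0\notin H$; (3) there exist a subgroup $H\le G$, two distinct elements $t_0,t_0'\in T_0$ and an element $t_1\in T_1$ such that $|H|=\delta(X)/2$, $t_0^{-1}(T_0\setminus\{t_0'\})\subseteq H$, $t_0^{-1}t_0'\notin H$, $(T_1\setminus\{t_1\})^{-1}t_0\subseteq H$ and $t_1^{-1}t_0\notin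 H$.
   Context: The Bi-Cayley digraph $BD(G,T_0,T_1)$ is the bipartite digraph with vertex set $G\times\{0,1\}$ and arc set $\{((g,0),(t_0g,1)) : g\in G,\ t_0\in T_0\}\cup\{((t_1g,1),(g,0)) : g\in G,\ t_1\in T_1\}$. For $S\subseteq G$, $S^{-1}=\{s^{-1}:s\in S\}$ and $Sg=\{sg:s\in S\}$, $gS=\{gs:s\in S\}$. $\delta(X)$ is the minimum of the minimum out-degree and minimum in-degree of $X$. The arc connectivity $\lambda(X)$ is the minimum cardinality of an arc set whose removal leaves a digraph that is not strongly connected; a minimum arc-cut is an arc set of cardinality $\lambda(X)$ whose removal leaves a digraph that is not strongly connected. $X$ is super-$\lambda$ (super arc-connected) if every minimum arc-cut of $X$ is either the set of all in-arcs of some vertex or the set of all out-arcs of some vertex. A directed cycle is a digraph isomorphic to the digraph on $\mathbb{Z}_n$ with arcs $(i,i+1)$; a symmetric cycle is the digraph obtained from an undirected cycle by replacing each edge $\{u,v\}$ with the two arcs $(u,v)$ and $(v,u)$.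
   Formalization: In condition (1)(a) only two distinct elements t_0, t_0' of T_0 are required (t_0'' is required only in (b)); with three the claim fails, e.g. for G=Z_2, T_0={0,1}, T_1={0}. *)

theory Defs
  imports
    "HOL-Algebra.Coset"
    "Graph_Theory.Digraph_Component"
    "Graph_Theory.Digraph_Isomorphism"
begin

definition bi_cayley_digraph ::
    "('a, 'b) monoid_scheme \<Rightarrow> 'a set \<Rightarrow> 'a set
      \<Rightarrow> ('a \<times> nat, ('a \<times> nat) \<times> ('a \<times> nat)) pre_digraph" where
  "bi_cayley_digraph G T\<^sub>0 T\<^sub>1 =
    \<lparr> verts = carrier G \<times> {0, 1},
      arcs = {((g, 0), (t\<^sub>0 \<otimes>\<^bsub>G\<^esub> g, 1)) | g t\<^sub>0. g \<in> carrier G \<and> t\<^sub>0 \<in> T\<^sub>0}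
           \<union> {((t\<^sub>1 \<otimes>\<^bsub>G\<^esub> g, 1), (g, 0)) | g t\<^sub>1. g \<in> carrier G \<and> t\<^sub>1 \<in> T\<^sub>1},
      tail = fst, head = snd \<rparr>"

text \<open>The numerical invariants below are meant for finite digraphs: \<^const>\<open>Min\<close> and
  \<^const>\<open>card\<close> are unspecified or \<open>0\<close> on infinite sets.\<close>

definition min_degree :: "('v, 'e) pre_digraph \<Rightarrow> nat" where
  "min_degree X = min (Min (out_degree X ` verts X)) (Min (in_degree X ` verts X))"

definition del_arcs :: "('v, 'e) pre_digraph \<Rightarrow> 'e set \<Rightarrow> ('v, 'e) pre_digraph" where
  "del_arcs X A = X\<lparr> arcs := arcs X - A \<rparr>"

definition arc_cut :: "('v, 'e) pre_digraph \<Rightarrow> 'e set \<Rightarrow> bool" where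
  "arc_cut X A \<longleftrightarrow> A \<subseteq> arcs X \<and> \<not> strongly_connected (del_arcs X A)"

definition arc_connectivity :: "('v, 'e) pre_digraph \<Rightarrow> nat" where
  "arc_connectivity X = (LEAST k. \<exists>A. arc_cut X A \<and> card A = k)"

definition min_arc_cut :: "('v, 'e) pre_digraph \<Rightarrow> 'e set \<Rightarrow> bool" where
  "min_arc_cut X A \<longleftrightarrow> arc_cut X A \<and> card A = arc_connectivity X"

definition super_arc_connected :: "('v, 'e) pre_digraph \<Rightarrow> bool" where
  "super_arc_connected X \<longleftrightarrow>
    (\<forall>A. min_arc_cut X A \<longrightarrow> (\<exists>v \<in> verts X. A = in_arcs X v \<or> A = out_arcs X v))"

definition cyclic_digraph :: "nat \<Rightarrow> nat pair_pre_digraph" where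
  "cyclic_digraph n = \<lparr> pverts = {..<n}, parcs = {(i, Suc i mod n) | i. i < n} \<rparr>"

definition directed_cycle :: "('v, 'e) pre_digraph \<Rightarrow> bool" where
  "directed_cycle X \<longleftrightarrow> (\<exists>n \<ge> 1. digraph_iso X (with_proj (cyclic_digraph n)))"

text \<open>An undirected cycle has length at least \<open>3\<close>; \<^const>\<open>mk_symmetric\<close> replaces each of its
  edges by the two opposite arcs.\<close>

definition symmetric_cycle :: "('v, 'e) pre_digraph \<Rightarrow> bool" where
  "symmetric_cycle X \<longleftrightarrow>
    (\<exists>n \<ge> 3. digraph_iso X (with_proj (mk_symmetric (with_proj (cyclic_digraph n)))))"

end

theory Submission
  imports Defs
begin

text \<open>
  Right translations act regularly on each of the two layers. Writing \<open>\<delta>\<close> for the smaller of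
  \<open>|T\<^sub>0|\<close> and \<open>|T\<^sub>1|\<close>, submodularity shows that a smallest set attaining the minimum directed cut is a
  block of this action, and a block has cut at least \<open>\<delta>\<close>; hence the arc connectivity is \<open>\<delta>\<close>.
  If the digraph is not super arc-connected, some set with at least two vertices inside and outside has
  a cut of size \<open>\<delta>\<close>, and a smallest such set is again a block. Up to translation a block that meets
  both layers is \<open>K \<times> {0} \<union> cK \<times> {1}\<close> for a subgroup \<open>K\<close>, and its cut has size
  \<open>|K| (|T\<^sub>0 - cK| + |T\<^sub>1 - cK|)\<close>. Equating this with \<open>\<delta>\<close> leaves \<open>|K| = \<delta>\<close> with a single element of
  \<open>T\<^sub>0\<close> or of \<open>T\<^sub>1\<close> outside \<open>cK\<close>, or \<open>|K| = 1\<close> with \<open>|T\<^sub>0| = |T\<^sub>1| = 2\<close>. Conversely, the cut of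
  such a pair of cosets is not a star as soon as \<open>T\<^sub>0\<close> and \<open>T\<^sub>1\<close> both meet \<open>cK\<close>.
\<close>

section \<open>Directed cuts\<close>

text \<open>The action has two orbits, so a set may meet the two layers in different numbers, and
  then its out-cut and in-cut can differ. Both kinds of cut are therefore minimised together: a set
  and its complement compete, which bounds a smallest set by half of the vertices, and a set
  attaining the minimum by its in-cut is treated by reversing all arcs. To have this reversal and
  the exchange of layers at hand, the argument runs on an abstract relation with an action instead
  of on the group. The obstacle lies in the second block argument. Stars are minimum cuts as well,
  so two translates of a smallest nontrivial set might share exactly one vertex, and submodularity
  does not exclude this. Posimodularity does if in-cut and out-cut agree; the remaining lopsided
  sets need a separate count of arcs. The directed cycle has to be set aside because for
  \<open>|T\<^sub>0| = |T\<^sub>1| = 1\<close> the coset found might miss \<open>T\<^sub>0\<close>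
  or \<open>T\<^sub>1\<close>.\<close>

definition arcs_between :: "('v \<times> 'v) set \<Rightarrow> 'v set \<Rightarrow> 'v set \<Rightarrow> nat" where
  "arcs_between E A B = card (E \<inter> A \<times> B)"

text \<open>The complement is taken in the whole type, which keeps the uncrossing inequalities free
  of a vertex set. This is harmless because all arcs have their ends in the vertex set, see
  \<open>arcs_between_Int\<close>.\<close>

abbreviation out_cut :: "('v \<times> 'v) set \<Rightarrow> 'v set \<Rightarrow> nat" where
  "out_cut E A \<equiv> arcs_between E A (- A)"

abbreviation in_cut :: "('v \<times> 'v) set \<Rightarrow> 'v set \<Rightarrow> nat" where
  "in_cut E A \<equiv> arcs_between E (- A) A"

lemma arcs_between_converse: "arcs_between (E\<inverse>) A B = arcs_between E B A"
proof -
  have "E\<inverse> \<inter> A \<times> B = (E \<inter> B \<times> A)\<inverse>" by auto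
  then show ?thesis unfolding arcs_between_def by (simp add: card_inverse)
qed

lemma arcs_between_Un_left:
  assumes "finite E" "A \<inter> A' = {}"
  shows "arcs_between E (A \<union> A') B = arcs_between E A B + arcs_between E A' B"
proof -
  have "E \<inter> (A \<union> A') \<times> B = (E \<inter> A \<times> B) \<union> (E \<inter> A' \<times> B)" by auto
  moreover have "(E \<inter> A \<times> B) \<inter> (E \<inter> A' \<times> B) = {}" using assms(2) by auto
  ultimately show ?thesis
    using assms(1) unfolding arcs_between_def by (simp add: card_Un_disjoint)
qed

lemma arcs_between_Un_right:
  assumes "finite E" "B \<inter> B' = {}"
  shows "arcs_between E A (B \<union> B') = arcs_between E A B + arcs_between E A B'"
  using arcs_between_Un_left[of "E\<inverse>" B B' A] assms by (simp add: arcs_between_converse)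

lemma arcs_between_mono:
  "\<lbrakk>finite E; A \<subseteq> A'; B \<subseteq> B'\<rbrakk> \<Longrightarrow> arcs_between E A B \<le> arcs_between E A' B'"
  unfolding arcs_between_def by (rule card_mono) auto

lemma arcs_between_Int:
  assumes "E \<subseteq> V \<times> V"
  shows "arcs_between E A B = arcs_between E (A \<inter> V) (B \<inter> V)"
  using assms unfolding arcs_between_def by (intro arg_cong[where f = card]) auto

lemma arcs_between_sum_left:
  assumes "finite E" "finite A"
  shows "arcs_between E A B = (\<Sum>a\<in>A. card (E `` {a} \<inter> B))"
proof -
  have "E \<inter> A \<times> B = (SIGMA a:A. E `` {a} \<inter> B)" by auto
  moreover have "finite (E `` {a} \<inter> B)" for a using assms(1) by (simp add: finite_Image)
  ultimately show ?thesis unfolding arcs_between_def by (simp add: assms(2))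
qed

text \<open>\<open>P\<close>, \<open>Q\<close>, \<open>R\<close>, \<open>S\<close> partition the
  type, so every cut splits into counts between two of them, and each uncrossing inequality becomes
  linear arithmetic in these counts.\<close>

lemma arcs_between_quadrants:
  fixes A B :: "'v set"
  assumes "finite E"
  defines "P \<equiv> A - B" and "Q \<equiv> A \<inter> B" and "R \<equiv> B - A" and "S \<equiv> - (A \<union> B)"
  shows "out_cut E A = arcs_between E P R + arcs_between E P S + arcs_between E Q R + arcs_between E Q S"
    and "out_cut E B = arcs_between E Q P + arcs_between E Q S + arcs_between E R P + arcs_between E R S"
    and "in_cut E B = arcs_between E P Q + arcs_between E S Q + arcs_between E P R + arcs_between E S R"
    and "out_cut E Q = arcs_between E Q P + arcs_between E Q R + arcs_between E Q S"
    and "out_cut E (A \<union> B) = arcs_between E P S + arcs_between E Q S + arcs_between E R S"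
    and "out_cut E P = arcs_between E P Q + arcs_between E P R + arcs_between E P S"
    and "out_cut E R = arcs_between E R P + arcs_between E R Q + arcs_between E R S"
    and "in_cut E R = arcs_between E P R + arcs_between E Q R + arcs_between E S R"
proof -
  have disj: "P \<inter> Q = {}" "P \<inter> R = {}" "P \<inter> S = {}" "Q \<inter> R = {}" "Q \<inter> S = {}" "R \<inter> S = {}"
    unfolding P_def Q_def R_def S_def by auto
  have "A = P \<union> Q" "- A = R \<union> S" "B = Q \<union> R" "- B = P \<union> S" "- Q = P \<union> (R \<union> S)"
    "A \<union> B = P \<union> (Q \<union> R)" "- (A \<union> B) = S" "- P = Q \<union> (R \<union> S)" "- R = P \<union> (Q \<union> S)"
    unfolding P_def Q_def R_def S_def by auto
  note eqs = this
  have disj': "P \<inter> (R \<union> S) = {}" "P \<inter> (Q \<union> R) = {}" "Q \<inter> (R \<union> S) = {}" "P \<inter> (Q \<union> S) = {}"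
    using disj by auto
  note simps = arcs_between_Un_left arcs_between_Un_right assms(1) disj disj'
  show "out_cut E A = arcs_between E P R + arcs_between E P S + arcs_between E Q R + arcs_between E Q S"
    unfolding eqs(2) by (subst eqs(1)) (simp add: simps)
  show "out_cut E B = arcs_between E Q P + arcs_between E Q S + arcs_between E R P + arcs_between E R S"
    unfolding eqs(4) by (subst eqs(3)) (simp add: simps)
  show "in_cut E B = arcs_between E P Q + arcs_between E S Q + arcs_between E P R + arcs_between E S R"
    unfolding eqs(4) by (subst eqs(3)) (simp add: simps)
  show "out_cut E Q = arcs_between E Q P + arcs_between E Q R + arcs_between E Q S"
    unfolding eqs(5) by (simp add: simps)
  show "out_cut E (A \<union> B) = arcs_between E P S + arcs_between E Q S + arcs_between E R S"
    unfolding eqs(7) by (subst eqs(6)) (simp add: simps)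
  show "out_cut E P = arcs_between E P Q + arcs_between E P R + arcs_between E P S"
    unfolding eqs(8) by (simp add: simps)
  show "out_cut E R = arcs_between E R P + arcs_between E R Q + arcs_between E R S"
    unfolding eqs(9) by (simp add: simps)
  show "in_cut E R = arcs_between E P R + arcs_between E Q R + arcs_between E S R"
    unfolding eqs(9) by (simp add: simps)
qed

text \<open>The two diagonal terms are kept because they must vanish when all four cuts are minimum;
  \<open>overlap\<close> records this for later counting.\<close>

lemma out_cut_submodular:
  assumes "finite E"
  shows "out_cut E A + out_cut E B = out_cut E (A \<inter> B) + out_cut E (A \<union> B)
    + arcs_between E (A - B) (B - A) + arcs_between E (B - A) (A - B)"
  using arcs_between_quadrants(1,2,4,5)[OF assms, where A = A and B = B] by linarith

text \<open>Uncrossing onto the differences works for an out-cut of \<open>A\<close> paired with an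
  in-cut of \<open>B\<close>. The slack consists of the arcs, in both directions, between
  \<open>A \<inter> B\<close> and the complement of \<open>A \<union> B\<close>.\<close>

lemma out_in_cut_posimodular:
  assumes "finite E"
  shows "out_cut E (A - B) + in_cut E (B - A) \<le> out_cut E A + in_cut E B"
  using arcs_between_quadrants(1,3,6,8)[OF assms, where A = A and B = B] by linarith

text \<open>The elements of \<open>\<Gamma>\<close> are total functions that matter only on the vertices, so identity and
  freeness are required there only. The axioms are symmetric under reversing all arcs and under
  exchanging the two parts, both of which exchange \<open>d\<^sub>0\<close> and \<open>d\<^sub>1\<close>.\<close>

locale biregular_bipartite_action =
  fixes V\<^sub>0 V\<^sub>1 :: "'v set" and E :: "('v \<times> 'v) set" and \<Gamma> :: "('v \<Rightarrow> 'v) set" and d\<^sub>0 d\<^sub>1 :: nat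
  assumes finite_parts: "finite V\<^sub>0" "finite V\<^sub>1"
    and disjoint_parts: "V\<^sub>0 \<inter> V\<^sub>1 = {}"
    and arcs_bipartite: "E \<subseteq> V\<^sub>0 \<times> V\<^sub>1 \<union> V\<^sub>1 \<times> V\<^sub>0"
    and out_degree: "u \<in> V\<^sub>0 \<Longrightarrow> card (E `` {u}) = d\<^sub>0" "u \<in> V\<^sub>1 \<Longrightarrow> card (E `` {u}) = d\<^sub>1"
    and in_degree: "u \<in> V\<^sub>0 \<Longrightarrow> card (E\<inverse> `` {u}) = d\<^sub>1" "u \<in> V\<^sub>1 \<Longrightarrow> card (E\<inverse> `` {u}) = d\<^sub>0"
    and out_cut_pos: "\<lbrakk>A \<subseteq> V\<^sub>0 \<union> V\<^sub>1; A \<noteq> {}; A \<noteq> V\<^sub>0 \<union> V\<^sub>1\<rbrakk> \<Longrightarrow> 0 < out_cut E A"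
    and act_parts: "\<gamma> \<in> \<Gamma> \<Longrightarrow> \<gamma> ` V\<^sub>0 = V\<^sub>0" "\<gamma> \<in> \<Gamma> \<Longrightarrow> \<gamma> ` V\<^sub>1 = V\<^sub>1"
    and act_arcs: "\<lbrakk>\<gamma> \<in> \<Gamma>; (u, v) \<in> E\<rbrakk> \<Longrightarrow> (\<gamma> u, \<gamma> v) \<in> E"
    and act_id: "\<exists>\<gamma>\<in>\<Gamma>. \<forall>v \<in> V\<^sub>0 \<union> V\<^sub>1. \<gamma> v = v"
    and act_free: "\<lbrakk>\<gamma> \<in> \<Gamma>; \<gamma>' \<in> \<Gamma>; u \<in> V\<^sub>0 \<union> V\<^sub>1; \<gamma> u = \<gamma>' u; v \<in> V\<^sub>0 \<union> V\<^sub>1\<rbrakk> \<Longrightarrow> \<gamma> v = \<gamma>' v"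
    and act_transitive: "\<lbrakk>u \<in> V\<^sub>0; v \<in> V\<^sub>0\<rbrakk> \<Longrightarrow> \<exists>\<gamma>\<in>\<Gamma>. \<gamma> u = v" "\<lbrakk>u \<in> V\<^sub>1; v \<in> V\<^sub>1\<rbrakk> \<Longrightarrow> \<exists>\<gamma>\<in>\<Gamma>. \<gamma> u = v"
begin

abbreviation V :: "'v set" where "V \<equiv> V\<^sub>0 \<union> V\<^sub>1"

abbreviation \<delta> :: nat where "\<delta> \<equiv> min d\<^sub>0 d\<^sub>1"

abbreviation block :: "'v set \<Rightarrow> bool" where
  "block A \<equiv> \<forall>\<gamma>\<in>\<Gamma>. \<gamma> ` A = A \<or> A \<inter> \<gamma> ` A = {}"

lemma finite_V: "finite V"
  using finite_parts by simp

lemma arcs_V: "E \<subseteq> V \<times> V"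
  using arcs_bipartite by auto

lemma finite_E: "finite E"
  by (rule finite_subset[OF arcs_V]) (simp add: finite_parts)

lemma in_cut_eq: "A \<subseteq> V \<Longrightarrow> in_cut E A = out_cut E (V - A)"
  using arcs_V unfolding arcs_between_def by (intro arg_cong[where f = card]) auto

lemma out_cut_eq: "A \<subseteq> V \<Longrightarrow> out_cut E A = in_cut E (V - A)"
  using arcs_V unfolding arcs_between_def by (intro arg_cong[where f = card]) auto

lemma swap_parts: "biregular_bipartite_action V\<^sub>1 V\<^sub>0 E \<Gamma> d\<^sub>1 d\<^sub>0"
proof
  show "V\<^sub>1 \<inter> V\<^sub>0 = {}" using disjoint_parts by auto
  show "0 < out_cut E A" if "A \<subseteq> V\<^sub>1 \<union> V\<^sub>0" "A \<noteq> {}" "A \<noteq> V\<^sub>1 \<union> V\<^sub>0" for A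
    using out_cut_pos[of A] that by (simp add: Un_commute)
  show "\<gamma> v = \<gamma>' v" if "\<gamma> \<in> \<Gamma>" "\<gamma>' \<in> \<Gamma>" "u \<in> V\<^sub>1 \<union> V\<^sub>0" "\<gamma> u = \<gamma>' u" "v \<in> V\<^sub>1 \<union> V\<^sub>0" for \<gamma> \<gamma>' u v
    using act_free[of \<gamma> \<gamma>' u v] that by (simp add: Un_commute)
  show "E \<subseteq> V\<^sub>1 \<times> V\<^sub>0 \<union> V\<^sub>0 \<times> V\<^sub>1" using arcs_bipartite by (simp add: Un_commute)
  show "\<exists>\<gamma>\<in>\<Gamma>. \<forall>v \<in> V\<^sub>1 \<union> V\<^sub>0. \<gamma> v = v" using act_id by (simp add: Un_commute)
qed (assumption | rule finite_parts out_degree in_degree act_parts act_transitive act_arcs)+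

lemma reverse_arcs: "biregular_bipartite_action V\<^sub>0 V\<^sub>1 (E\<inverse>) \<Gamma> d\<^sub>1 d\<^sub>0"
proof
  show "0 < out_cut (E\<inverse>) A" if "A \<subseteq> V" "A \<noteq> {}" "A \<noteq> V" for A
  proof -
    have "V - A \<noteq> {}" "V - A \<noteq> V" using that by auto
    then show ?thesis
      using out_cut_pos[of "V - A"] in_cut_eq[OF that(1)] by (simp add: arcs_between_converse)
  qed
  show "E\<inverse> \<subseteq> V\<^sub>0 \<times> V\<^sub>1 \<union> V\<^sub>1 \<times> V\<^sub>0" using arcs_bipartite by auto
  show "(\<gamma> u, \<gamma> v) \<in> E\<inverse>" if "\<gamma> \<in> \<Gamma>" "(u, v) \<in> E\<inverse>" for \<gamma> u v
    using act_arcs that by simp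
  show "card ((E\<inverse>)\<inverse> `` {u}) = d\<^sub>0" if "u \<in> V\<^sub>0" for u using out_degree(1)[OF that] by simp
  show "card ((E\<inverse>)\<inverse> `` {u}) = d\<^sub>1" if "u \<in> V\<^sub>1" for u using out_degree(2)[OF that] by simp
  show "\<gamma> v = \<gamma>' v" if "\<gamma> \<in> \<Gamma>" "\<gamma>' \<in> \<Gamma>" "u \<in> V" "\<gamma> u = \<gamma>' u" "v \<in> V" for \<gamma> \<gamma>' u v
    using act_free that by blast
qed (assumption | rule finite_parts disjoint_parts in_degree act_parts act_id act_transitive)+

section \<open>Invariance of arcs and cuts under the action\<close>

lemma act_V: "\<gamma> \<in> \<Gamma> \<Longrightarrow> \<gamma> ` V = V"
  using act_parts by (simp add: image_Un)

lemma act_inj: "\<gamma> \<in> \<Gamma> \<Longrightarrow> inj_on \<gamma> V"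
  using act_V finite_V by (simp add: eq_card_imp_inj_on)

text \<open>The locale only asks that arcs map to arcs; injectivity on the finite set
  \<open>E\<close> makes the map onto.\<close>

lemma act_arcs_image:
  assumes "\<gamma> \<in> \<Gamma>"
  shows "map_prod \<gamma> \<gamma> ` E = E"
proof (rule endo_inj_surj[OF finite_E])
  show "map_prod \<gamma> \<gamma> ` E \<subseteq> E" using act_arcs[OF assms] by auto
  show "inj_on (map_prod \<gamma> \<gamma>) E"
    using map_prod_inj_on[OF act_inj act_inj, OF assms assms] arcs_V by (rule inj_on_subset)
qed

lemma arcs_between_act:
  assumes "\<gamma> \<in> \<Gamma>" "A \<subseteq> V" "B \<subseteq> V"
  shows "arcs_between E (\<gamma> ` A) (\<gamma> ` B) = arcs_between E A B"
proof -
  have "E \<inter> \<gamma> ` A \<times> \<gamma> ` B = map_prod \<gamma> \<gamma> ` (E \<inter> A \<times> B)"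
  proof
    show "E \<inter> \<gamma> ` A \<times> \<gamma> ` B \<subseteq> map_prod \<gamma> \<gamma> ` (E \<inter> A \<times> B)"
    proof
      fix e assume e: "e \<in> E \<inter> \<gamma> ` A \<times> \<gamma> ` B"
      then obtain a b where ab: "e = (\<gamma> a, \<gamma> b)" "a \<in> A" "b \<in> B" by auto
      from e have "e \<in> map_prod \<gamma> \<gamma> ` E" using act_arcs_image[OF assms(1)] by simp
      then obtain u v where uv: "e = (\<gamma> u, \<gamma> v)" "(u, v) \<in> E" by auto
      have "u \<in> V" "v \<in> V" using uv(2) arcs_V by auto
      moreover have "a \<in> V" "b \<in> V" using ab assms by auto
      ultimately have "u = a" "v = b"
        using ab(1) uv(1) act_inj[OF assms(1)] unfolding inj_on_def by auto
      then show "e \<in> map_prod \<gamma> \<gamma> ` (E \<inter> A \<times> B)" using ab uv by auto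
    qed
  qed (use act_arcs[OF assms(1)] in auto)
  moreover have "inj_on (map_prod \<gamma> \<gamma>) (E \<inter> A \<times> B)"
    using map_prod_inj_on[OF act_inj act_inj, OF assms(1) assms(1)] arcs_V
    by (meson inf.coboundedI1 inj_on_subset)
  ultimately show ?thesis unfolding arcs_between_def by (simp add: card_image)
qed

lemma act_Compl:
  assumes "\<gamma> \<in> \<Gamma>" "A \<subseteq> V"
  shows "V - \<gamma> ` A = \<gamma> ` (V - A)"
  using act_V[OF assms(1)] inj_on_image_set_diff[OF act_inj[OF assms(1)], of V A] assms(2) by simp

lemma cut_act:
  assumes "\<gamma> \<in> \<Gamma>" "A \<subseteq> V"
  shows "out_cut E (\<gamma> ` A) = out_cut E A" and "in_cut E (\<gamma> ` A) = in_cut E A"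
proof -
  have sub: "\<gamma> ` A \<subseteq> V" using act_V[OF assms(1)] assms(2) by blast
  have *: "- B \<inter> V = V - B" for B by blast
  have "out_cut E (\<gamma> ` A) = arcs_between E (\<gamma> ` A) (\<gamma> ` (V - A))"
    using arcs_between_Int[OF arcs_V, of "\<gamma> ` A" "- \<gamma> ` A"] sub act_Compl[OF assms]
    by (simp add: * Int_absorb2)
  then show "out_cut E (\<gamma> ` A) = out_cut E A"
    using arcs_between_Int[OF arcs_V, of A "- A"] assms(2) arcs_between_act[OF assms, of "V - A"]
    by (simp add: * Int_absorb2)
  have "in_cut E (\<gamma> ` A) = arcs_between E (\<gamma> ` (V - A)) (\<gamma> ` A)"
    using arcs_between_Int[OF arcs_V, of "- \<gamma> ` A" "\<gamma> ` A"] sub act_Compl[OF assms]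
    by (simp add: * Int_absorb2)
  then show "in_cut E (\<gamma> ` A) = in_cut E A"
    using arcs_between_Int[OF arcs_V, of "- A" A] assms(2)
      arcs_between_act[OF assms(1) _ assms(2), of "V - A"]
    by (simp add: * Int_absorb2)
qed

lemma card_act: "\<lbrakk>\<gamma> \<in> \<Gamma>; A \<subseteq> V\<rbrakk> \<Longrightarrow> card (\<gamma> ` A) = card A"
  using act_inj by (meson card_image inj_on_subset)

lemma act_subset: "\<lbrakk>\<gamma> \<in> \<Gamma>; A \<subseteq> V\<rbrakk> \<Longrightarrow> \<gamma> ` A \<subseteq> V"
  using act_V by blast

section \<open>Counting arcs by degrees\<close>

lemma out_arcs_parts:
  assumes "finite A"
  shows "A \<subseteq> V\<^sub>0 \<Longrightarrow> arcs_between E A UNIV = d\<^sub>0 * card A"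
    and "A \<subseteq> V\<^sub>1 \<Longrightarrow> arcs_between E A UNIV = d\<^sub>1 * card A"
proof -
  have "arcs_between E A UNIV = (\<Sum>a\<in>A. d\<^sub>0)" if "A \<subseteq> V\<^sub>0"
    using that unfolding arcs_between_sum_left[OF finite_E assms]
    by (intro sum.cong) (auto simp: out_degree)
  then show "A \<subseteq> V\<^sub>0 \<Longrightarrow> arcs_between E A UNIV = d\<^sub>0 * card A" by simp
  have "arcs_between E A UNIV = (\<Sum>a\<in>A. d\<^sub>1)" if "A \<subseteq> V\<^sub>1"
    using that unfolding arcs_between_sum_left[OF finite_E assms]
    by (intro sum.cong) (auto simp: out_degree)
  then show "A \<subseteq> V\<^sub>1 \<Longrightarrow> arcs_between E A UNIV = d\<^sub>1 * card A" by simp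
qed

lemma Int_parts: "(A \<inter> V\<^sub>0) \<inter> (A \<inter> V\<^sub>1) = {}"
  using disjoint_parts by auto

lemma Un_parts: "A \<subseteq> V \<Longrightarrow> (A \<inter> V\<^sub>0) \<union> (A \<inter> V\<^sub>1) = A"
  by auto

lemma out_cut_balance:
  assumes "A \<subseteq> V"
  shows "out_cut E A + arcs_between E A A = d\<^sub>0 * card (A \<inter> V\<^sub>0) + d\<^sub>1 * card (A \<inter> V\<^sub>1)"
proof -
  have "out_cut E A + arcs_between E A A = arcs_between E A UNIV"
    using arcs_between_Un_right[OF finite_E, of "- A" A A] by simp
  also have "\<dots> = arcs_between E (A \<inter> V\<^sub>0) UNIV + arcs_between E (A \<inter> V\<^sub>1) UNIV"
    using arcs_between_Un_left[OF finite_E Int_parts, of A UNIV] Un_parts[OF assms] by simp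
  finally show ?thesis using out_arcs_parts finite_parts by simp
qed

text \<open>Compared with \<open>out_cut_balance\<close>, over the integers, the out-cut minus the
  in-cut is \<open>(d\<^sub>0 - d\<^sub>1) * (a\<^sub>0 - a\<^sub>1)\<close>, where
  \<open>a\<^sub>0\<close> and \<open>a\<^sub>1\<close> count the vertices of \<open>A\<close> in
  the two parts. Sets with balanced parts thus have equal cuts.\<close>

lemma in_cut_balance:
  assumes "A \<subseteq> V"
  shows "in_cut E A + arcs_between E A A = d\<^sub>1 * card (A \<inter> V\<^sub>0) + d\<^sub>0 * card (A \<inter> V\<^sub>1)"
  using biregular_bipartite_action.out_cut_balance[OF reverse_arcs assms]
  by (simp add: arcs_between_converse)

lemma card_parts: "A \<subseteq> V \<Longrightarrow> card A = card (A \<inter> V\<^sub>0) + card (A \<inter> V\<^sub>1)"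
  using card_Un_disjoint[OF _ _ Int_parts, of A] Un_parts[of A] finite_parts by simp

lemma out_cut_part:
  shows "A \<subseteq> V\<^sub>0 \<Longrightarrow> out_cut E A = d\<^sub>0 * card A" and "A \<subseteq> V\<^sub>1 \<Longrightarrow> out_cut E A = d\<^sub>1 * card A"
proof -
  have *: "E \<inter> A \<times> A = {}" if "A \<subseteq> V\<^sub>0 \<or> A \<subseteq> V\<^sub>1"
    using that arcs_bipartite disjoint_parts by blast
  show "out_cut E A = d\<^sub>0 * card A" if "A \<subseteq> V\<^sub>0"
  proof -
    have "A \<inter> V\<^sub>0 = A" "A \<inter> V\<^sub>1 = {}" using that disjoint_parts by auto
    then show ?thesis using out_cut_balance[of A] that * unfolding arcs_between_def by (simp add: subset_iff)
  qed
  show "out_cut E A = d\<^sub>1 * card A" if "A \<subseteq> V\<^sub>1"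
  proof -
    have "A \<inter> V\<^sub>1 = A" "A \<inter> V\<^sub>0 = {}" using that disjoint_parts by auto
    then show ?thesis using out_cut_balance[of A] that * unfolding arcs_between_def by (simp add: subset_iff)
  qed
qed

section \<open>Stabilisers and blocks\<close>

lemma act_mem_iff:
  assumes "\<gamma> \<in> \<Gamma>" "A \<subseteq> V" "\<gamma> ` A = A" "v \<in> V"
  shows "\<gamma> v \<in> A \<longleftrightarrow> v \<in> A"
proof
  assume "\<gamma> v \<in> A"
  then obtain a where "a \<in> A" "\<gamma> v = \<gamma> a" using assms(3) by auto
  then show "v \<in> A" using act_inj[OF assms(1)] assms(2,4) by (metis inj_onD subsetD)
qed (use assms(3) in auto)

text \<open>Fix one arc of the cut. Elements that stabilise \<open>A\<close> and send
  \<open>u\<close> to different vertices of \<open>S\<close> move this arc to different arcs of the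
  cut, by freeness.\<close>

lemma card_le_out_cut:
  assumes "A \<subseteq> V" "A \<noteq> {}" "A \<noteq> V" "u \<in> V" "finite S"
    and stab: "\<And>a. a \<in> S \<Longrightarrow> \<exists>\<gamma>\<in>\<Gamma>. \<gamma> u = a \<and> \<gamma> ` A = A"
  shows "card S \<le> out_cut E A"
proof -
  obtain F where F: "\<And>a. a \<in> S \<Longrightarrow> F a \<in> \<Gamma> \<and> F a u = a \<and> F a ` A = A"
    using stab by metis
  have "E \<inter> A \<times> (- A) \<noteq> {}"
    using out_cut_pos[OF assms(1-3)] unfolding arcs_between_def by (metis card.empty less_numeral_extra(3))
  then obtain x y where xy: "(x, y) \<in> E" "x \<in> A" "y \<notin> A" by auto
  have V: "x \<in> V" "y \<in> V" using xy(1) arcs_V by auto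
  have "inj_on (\<lambda>a. (F a x, F a y)) S"
  proof (rule inj_onI)
    fix a b assume ab: "a \<in> S" "b \<in> S" "(F a x, F a y) = (F b x, F b y)"
    then have "F a u = F b u" using act_free[of "F a" "F b" x u] F V(1) assms(4) by auto
    then show "a = b" using F ab by metis
  qed
  moreover have "(\<lambda>a. (F a x, F a y)) ` S \<subseteq> E \<inter> A \<times> (- A)"
  proof
    fix e assume "e \<in> (\<lambda>a. (F a x, F a y)) ` S"
    then obtain a where a: "a \<in> S" "e = (F a x, F a y)" by auto
    then show "e \<in> E \<inter> A \<times> (- A)"
      using F[OF a(1)] xy V act_arcs act_mem_iff[of "F a" A] assms(1) by auto
  qed
  ultimately show ?thesis unfolding arcs_between_def
    by (metis card_inj_on_le finite_Int finite_E)
qed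

lemma block_stab:
  assumes "A \<subseteq> V" "block A" "u \<in> A" "a \<in> A" "u \<in> V\<^sub>0 \<and> a \<in> V\<^sub>0 \<or> u \<in> V\<^sub>1 \<and> a \<in> V\<^sub>1"
  shows "\<exists>\<gamma>\<in>\<Gamma>. \<gamma> u = a \<and> \<gamma> ` A = A"
proof -
  obtain \<gamma> where "\<gamma> \<in> \<Gamma>" "\<gamma> u = a" using assms(5) act_transitive by blast
  then show ?thesis using assms(2-4) by blast
qed

text \<open>The elements carrying \<open>u\<close> to the vertices of
  \<open>A \<inter> V\<^sub>0\<close> stabilise the block, and freeness makes their values at
  \<open>w\<close> distinct vertices of \<open>A \<inter> V\<^sub>1\<close>.\<close>

lemma block_card_part_le:
  assumes "A \<subseteq> V" "block A" "u \<in> A \<inter> V\<^sub>0" "w \<in> A \<inter> V\<^sub>1"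
  shows "card (A \<inter> V\<^sub>0) \<le> card (A \<inter> V\<^sub>1)"
proof -
  obtain F where F: "\<And>a. a \<in> A \<inter> V\<^sub>0 \<Longrightarrow> F a \<in> \<Gamma> \<and> F a u = a \<and> F a ` A = A"
    using block_stab[OF assms(1,2), of u] assms(3) by (metis IntE)
  have "inj_on (\<lambda>a. F a w) (A \<inter> V\<^sub>0)"
  proof (rule inj_onI)
    fix a b assume ab: "a \<in> A \<inter> V\<^sub>0" "b \<in> A \<inter> V\<^sub>0" "F a w = F b w"
    then have "F a u = F b u" using act_free[of "F a" "F b" w u] F assms by auto
    then show "a = b" using F ab by metis
  qed
  moreover have "(\<lambda>a. F a w) ` (A \<inter> V\<^sub>0) \<subseteq> A \<inter> V\<^sub>1"
    using F act_parts(2) assms(4) by blast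
  ultimately show ?thesis using finite_parts by (meson card_inj_on_le finite_Int)
qed

lemma block_card_parts:
  assumes "A \<subseteq> V" "block A" "A \<inter> V\<^sub>0 \<noteq> {}" "A \<inter> V\<^sub>1 \<noteq> {}"
  shows "card (A \<inter> V\<^sub>0) = card (A \<inter> V\<^sub>1)"
proof -
  interpret swap: biregular_bipartite_action V\<^sub>1 V\<^sub>0 E \<Gamma> d\<^sub>1 d\<^sub>0 by (rule swap_parts)
  obtain u w where "u \<in> A \<inter> V\<^sub>0" "w \<in> A \<inter> V\<^sub>1" using assms(3,4) by blast
  moreover have "A \<subseteq> V\<^sub>1 \<union> V\<^sub>0" using assms(1) by blast
  ultimately show ?thesis
    using block_card_part_le[OF assms(1,2)] swap.block_card_part_le[OF _ assms(2)] by (meson le_antisym)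
qed

lemma block_out_cut_eq_in_cut:
  assumes "A \<subseteq> V" "block A" "A \<inter> V\<^sub>0 \<noteq> {}" "A \<inter> V\<^sub>1 \<noteq> {}"
  shows "out_cut E A = in_cut E A"
  using out_cut_balance[OF assms(1)] in_cut_balance[OF assms(1)] block_card_parts[OF assms] by simp

text \<open>Within one part the cut is a degree times \<open>card A\<close>. A block with
  \<open>h\<close> vertices in each part has a cut of at least \<open>h\<close>, by moving one arc
  around, and of at least \<open>2 * h * (\<delta> - h)\<close>, since at most
  \<open>2 * h * h\<close> arcs stay inside. For \<open>1 \<le> h\<close> one of the two bounds
  reaches \<delta>.\<close>

lemma block_out_cut_ge:
  assumes "A \<subseteq> V" "A \<noteq> {}" "A \<noteq> V" "block A"
  shows "\<delta> \<le> out_cut E A"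
proof -
  have fin: "finite A" using assms(1) finite_V by (rule finite_subset)
  have pos: "0 < card A" using fin assms(2) by (simp add: card_gt_0_iff)
  consider "A \<subseteq> V\<^sub>0" | "A \<subseteq> V\<^sub>1" | "A \<inter> V\<^sub>0 \<noteq> {}" "A \<inter> V\<^sub>1 \<noteq> {}"
    using assms(1) by blast
  then show ?thesis
  proof cases
    case 1
    then have "out_cut E A = d\<^sub>0 * card A" by (rule out_cut_part)
    also have "\<dots> \<ge> d\<^sub>0 * 1" using pos by (intro mult_le_mono2) simp
    finally show ?thesis by simp
  next
    case 2
    then have "out_cut E A = d\<^sub>1 * card A" by (rule out_cut_part)
    also have "\<dots> \<ge> d\<^sub>1 * 1" using pos by (intro mult_le_mono2) simp
    finally show ?thesis by simp
  next
    case 3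
    define h where "h = card (A \<inter> V\<^sub>0)"
    have h1: "h = card (A \<inter> V\<^sub>1)"
      unfolding h_def using block_card_parts assms(1,4) 3 by blast
    have "1 \<le> h" unfolding h_def using 3(1) finite_parts(1)
      by (simp add: Suc_le_eq card_gt_0_iff)
    obtain u where u: "u \<in> A \<inter> V\<^sub>0" using 3 by blast
    have "h \<le> out_cut E A" unfolding h_def
      by (rule card_le_out_cut[OF assms(1-3), of u])
        (use u finite_parts block_stab[OF assms(1,4)] in auto)
    moreover have "\<delta> \<le> out_cut E A" if "h < \<delta>"
    proof -
      have "E \<inter> A \<times> A \<subseteq> (A \<inter> V\<^sub>0) \<times> (A \<inter> V\<^sub>1) \<union> (A \<inter> V\<^sub>1) \<times> (A \<inter> V\<^sub>0)"
        using arcs_bipartite by blast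
      then have "arcs_between E A A \<le> card ((A \<inter> V\<^sub>0) \<times> (A \<inter> V\<^sub>1) \<union> (A \<inter> V\<^sub>1) \<times> (A \<inter> V\<^sub>0))"
        unfolding arcs_between_def using finite_parts by (intro card_mono) auto
      also have "\<dots> \<le> h * h + h * h"
        using card_Un_le[of "(A \<inter> V\<^sub>0) \<times> (A \<inter> V\<^sub>1)" "(A \<inter> V\<^sub>1) \<times> (A \<inter> V\<^sub>0)"] h1
        by (simp add: card_cartesian_product h_def)
      finally have int: "arcs_between E A A \<le> h * h + h * h" .
      have "d\<^sub>0 * h + d\<^sub>1 * h = out_cut E A + arcs_between E A A"
        using out_cut_balance[OF assms(1)] h1 h_def by simp
      moreover have "\<delta> * h + \<delta> * h \<le> d\<^sub>0 * h + d\<^sub>1 * h"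
        by (intro add_mono mult_le_mono1) auto
      ultimately have *: "\<delta> * h + \<delta> * h \<le> out_cut E A + h * h + h * h" using int by linarith
      \<comment> \<open>Subtraction-free form: \<open>\<delta> \<le> 2 * h * (\<delta> - h)\<close>
        turns into \<open>h' + k' + 2 \<le> 2 * (h' + 1) * (k' + 1)\<close>.\<close>
      define h' k' where "h' = h - 1" and "k' = \<delta> - h - 1"
      then have hk: "h = Suc h'" "\<delta> = Suc h' + Suc k'" using that \<open>1 \<le> h\<close> by linarith+
      show ?thesis using * unfolding hk by (simp add: algebra_simps)
    qed
    ultimately show ?thesis by linarith
  qed
qed

text \<open>Since in-cuts compete as well, the complement of \<open>A\<close> is a candidate and
  \<open>A\<close> has at most half of the vertices. Two translates that meet therefore do not cover
  \<open>V\<close>, submodularity makes their intersection attain the minimum, and minimal size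
  forces them to coincide.\<close>

lemma atom_block:
  assumes "A \<subseteq> V" "A \<noteq> {}" "A \<noteq> V"
    and least: "\<And>B. \<lbrakk>B \<subseteq> V; B \<noteq> {}; B \<noteq> V\<rbrakk> \<Longrightarrow> out_cut E A \<le> out_cut E B"
    and smallest: "\<And>B. \<lbrakk>B \<subseteq> V; B \<noteq> {}; B \<noteq> V; out_cut E B = out_cut E A \<or> in_cut E B = out_cut E A\<rbrakk>
      \<Longrightarrow> card A \<le> card B"
  shows "block A"
proof (intro ballI disjCI)
  fix \<gamma> assume \<gamma>: "\<gamma> \<in> \<Gamma>"
  assume meet: "A \<inter> \<gamma> ` A \<noteq> {}"
  let ?B = "\<gamma> ` A"
  have fin: "finite A" using assms(1) finite_V by (rule finite_subset)
  have "in_cut E (V - A) = out_cut E A" using out_cut_eq[OF assms(1)] by simp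
  then have half: "card A \<le> card (V - A)"
    by (intro smallest) (use assms in auto)
  have "card (V - A) = card V - card A" using fin assms(1) by (simp add: card_Diff_subset)
  then have cV: "2 * card A \<le> card V" using half card_mono[OF finite_V assms(1)] by linarith
  have "card (A \<union> ?B) + card (A \<inter> ?B) = 2 * card A"
    using card_Un_Int[OF fin, of ?B] fin card_act[OF \<gamma> assms(1)] by simp
  moreover have "0 < card (A \<inter> ?B)" using meet fin by (simp add: card_gt_0_iff)
  ultimately have "A \<union> ?B \<noteq> V" using cV by auto
  then have "out_cut E A \<le> out_cut E (A \<union> ?B)"
    using least[of "A \<union> ?B"] assms(1,2) act_subset[OF \<gamma> assms(1)] by blast
  moreover have "out_cut E A \<le> out_cut E (A \<inter> ?B)"
    using least[of "A \<inter> ?B"] assms meet by blast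
  ultimately have "out_cut E (A \<inter> ?B) = out_cut E A"
    using out_cut_submodular[OF finite_E, of A ?B] cut_act(1)[OF \<gamma> assms(1)] by linarith
  then have "card A \<le> card (A \<inter> ?B)" using smallest[of "A \<inter> ?B"] assms meet by blast
  then have "A \<inter> ?B = A" using fin by (meson Int_lower1 card_seteq)
  then have "A \<subseteq> ?B" by blast
  then show "?B = A" using card_act[OF \<gamma> assms(1)] fin by (metis card_subset_eq finite_imageI)
qed

text \<open>Complementation exchanges out-cuts and in-cuts, so the least out-cut \<open>l\<close>
  bounds in-cuts too. A smallest set attaining \<open>l\<close> in either direction is an atom of
  \<open>E\<close> or of its converse, hence a block, to which \<open>block_out_cut_ge\<close>
  applies.\<close>

theorem arc_cut_ge_min_degree:
  assumes "A \<subseteq> V" "A \<noteq> {}" "A \<noteq> V"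
  shows "\<delta> \<le> out_cut E A" and "\<delta> \<le> in_cut E A"
proof -
  interpret rev: biregular_bipartite_action V\<^sub>0 V\<^sub>1 "E\<inverse>" \<Gamma> d\<^sub>1 d\<^sub>0 by (rule reverse_arcs)
  define proper where "proper B \<longleftrightarrow> B \<subseteq> V \<and> B \<noteq> {} \<and> B \<noteq> V" for B
  have properA: "proper A" using assms proper_def by simp
  have properC: "proper (V - B)" if "proper B" for B using that unfolding proper_def by auto
  define l where "l = (LEAST m. \<exists>B. proper B \<and> out_cut E B = m)"
  have ex: "\<exists>m B. proper B \<and> out_cut E B = m" using properA by blast
  have l_att: "\<exists>B. proper B \<and> out_cut E B = l" unfolding l_def by (rule LeastI_ex[OF ex])
  have l_le: "l \<le> out_cut E B" if "proper B" for B
    unfolding l_def by (rule Least_le) (use that in blast)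
  have l_le': "l \<le> in_cut E B" if "proper B" for B
    using l_le[OF properC[OF that]] in_cut_eq[of B] that unfolding proper_def by simp
  obtain B where B: "proper B" "out_cut E B = l \<or> in_cut E B = l"
    and B_min: "\<And>C. proper C \<Longrightarrow> out_cut E C = l \<or> in_cut E C = l \<Longrightarrow> card B \<le> card C"
    using arg_min_nat_lemma[of "\<lambda>B. proper B \<and> (out_cut E B = l \<or> in_cut E B = l)" _ card] l_att
    by blast
  have "\<delta> \<le> l"
    using B(2)
  proof
    assume o: "out_cut E B = l"
    have "block B"
      by (rule atom_block) (use B(1) l_le B_min in \<open>auto simp: proper_def o\<close>)
    then show ?thesis using block_out_cut_ge[of B] B(1) o unfolding proper_def by blast
  next
    assume i: "in_cut E B = l"
    have "block B"
      by (rule rev.atom_block) (use B(1) l_le' B_min in \<open>auto simp: proper_def i arcs_between_converse\<close>)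
    then show ?thesis
      using rev.block_out_cut_ge[of B] B(1) i unfolding proper_def arcs_between_converse
      by (simp add: min.commute)
  qed
  then show "\<delta> \<le> out_cut E A" "\<delta> \<le> in_cut E A"
    using l_le[OF properA] l_le'[OF properA] by linarith+
qed

end

section \<open>Superatoms\<close>

text \<open>Two vertices on either side keep away the sets whose cuts are stars. Competition between
  both kinds of cut serves the same purpose as in \<open>atom_block\<close>; that \<open>A\<close>
  attains \<delta> by its out-cut is a normalisation supplied by arc reversal.\<close>

locale superatom = biregular_bipartite_action +
  fixes A
  assumes subset: "A \<subseteq> V"
    and card_ge: "2 \<le> card A" "2 \<le> card (V - A)"
    and cut: "out_cut E A = \<delta>"
    and smallest: "\<And>B. \<lbrakk>B \<subseteq> V; 2 \<le> card B; 2 \<le> card (V - B); out_cut E B = \<delta> \<or> in_cut E B = \<delta>\<rbrakk>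
      \<Longrightarrow> card A \<le> card B"
begin

lemma swap_superatom: "superatom V\<^sub>1 V\<^sub>0 E \<Gamma> d\<^sub>1 d\<^sub>0 A"
proof -
  interpret swap: biregular_bipartite_action V\<^sub>1 V\<^sub>0 E \<Gamma> d\<^sub>1 d\<^sub>0 by (rule swap_parts)
  have *: "V\<^sub>1 \<union> V\<^sub>0 = V" "min d\<^sub>1 d\<^sub>0 = \<delta>" by auto
  show ?thesis
    by unfold_locales (use subset card_ge cut smallest in \<open>simp_all add: *\<close>)
qed

lemma superatom_act:
  assumes "\<gamma> \<in> \<Gamma>"
  shows "superatom V\<^sub>0 V\<^sub>1 E \<Gamma> d\<^sub>0 d\<^sub>1 (\<gamma> ` A)"
proof
  show "\<gamma> ` A \<subseteq> V" by (rule act_subset[OF assms subset])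
  show "2 \<le> card (\<gamma> ` A)" "2 \<le> card (V - \<gamma> ` A)"
    using card_ge card_act[OF assms, of A] card_act[OF assms, of "V - A"]
      act_Compl[OF assms subset] subset by auto
  show "out_cut E (\<gamma> ` A) = \<delta>" using cut_act(1)[OF assms subset] cut by simp
  show "card (\<gamma> ` A) \<le> card C"
    if "C \<subseteq> V" "2 \<le> card C" "2 \<le> card (V - C)" "out_cut E C = \<delta> \<or> in_cut E C = \<delta>" for C
    using smallest[OF that] card_act[OF assms subset] by simp
qed

lemma finite_A: "finite A"
  using subset finite_V by (rule finite_subset)

lemma proper: "A \<noteq> {}" "A \<noteq> V"
  using card_ge by auto

lemma min_degree_pos: "0 < \<delta>"
  using out_cut_pos[OF subset proper] cut by simp

lemma card_le_half: "2 * card A \<le> card V"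
proof -
  have "card A \<le> card (V - A)"
    using out_cut_eq[OF subset] cut card_ge subset by (intro smallest) (auto simp: double_diff)
  then show ?thesis
    using card_Diff_subset[OF finite_A subset] card_mono[OF finite_V subset] by linarith
qed

text \<open>Equality would make \<open>B\<close> a smaller competitor. This strictness is what
  refutes the uncrossing inequalities below.\<close>

lemma smaller_cut_gt:
  assumes "B \<subset> A" "2 \<le> card B"
  shows "\<delta> < out_cut E B" and "\<delta> < in_cut E B"
proof -
  have B: "B \<subseteq> V" "B \<noteq> {}" "B \<noteq> V" using assms subset by auto
  have "card B < card A" using assms(1) finite_A by (rule psubset_card_mono[rotated])
  moreover have "2 \<le> card (V - B)"
    using card_ge(2) card_mono[of "V - B" "V - A"] assms(1) finite_V by fastforce
  ultimately have "out_cut E B \<noteq> \<delta>" "in_cut E B \<noteq> \<delta>"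
    using smallest[of B] B(1) assms(2) by linarith+
  then show "\<delta> < out_cut E B" "\<delta> < in_cut E B"
    using arc_cut_ge_min_degree[OF B] by linarith+
qed

text \<open>Inside one part the cut would be a degree times \<open>card A\<close>, hence at least
  \<open>2 * \<delta>\<close>.\<close>

lemma parts_nonempty: "A \<inter> V\<^sub>0 \<noteq> {}" "A \<inter> V\<^sub>1 \<noteq> {}"
proof -
  have "2 * \<delta> \<le> d\<^sub>0 * card A" "2 * \<delta> \<le> d\<^sub>1 * card A"
    using mult_le_mono[of 2 "card A" \<delta> d\<^sub>0] mult_le_mono[of 2 "card A" \<delta> d\<^sub>1] card_ge(1)
    by (simp_all add: mult.commute)
  then have "\<not> A \<subseteq> V\<^sub>1" "\<not> A \<subseteq> V\<^sub>0"
    using cut min_degree_pos out_cut_part[of A] by auto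
  then show "A \<inter> V\<^sub>0 \<noteq> {}" "A \<inter> V\<^sub>1 \<noteq> {}" using subset by auto
qed

text \<open>Submodularity makes union and intersection attain \<delta> and leaves nothing for the
  diagonal arcs. Minimality of \<open>A\<close> concerns only sets with two or more vertices, so a
  one-vertex intersection survives.\<close>

lemma overlap:
  assumes "\<gamma> \<in> \<Gamma>" "\<gamma> ` A \<noteq> A" "A \<inter> \<gamma> ` A \<noteq> {}"
  obtains v where "A \<inter> \<gamma> ` A = {v}" "out_cut E {v} = \<delta>"
    "arcs_between E (A - \<gamma> ` A) (\<gamma> ` A - A) = 0" "arcs_between E (\<gamma> ` A - A) (A - \<gamma> ` A) = 0"
proof -
  let ?B = "\<gamma> ` A"
  have cardB: "card ?B = card A" by (rule card_act[OF assms(1) subset])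
  have "card (A \<union> ?B) + card (A \<inter> ?B) = 2 * card A"
    using card_Un_Int[OF finite_A, of ?B] finite_A cardB by simp
  moreover have "0 < card (A \<inter> ?B)" using assms(3) finite_A by (simp add: card_gt_0_iff)
  ultimately have "A \<union> ?B \<noteq> V" using card_le_half by auto
  then have "\<delta> \<le> out_cut E (A \<union> ?B)"
    using arc_cut_ge_min_degree(1)[of "A \<union> ?B"] subset proper act_subset[OF assms(1) subset] by blast
  moreover have "\<delta> \<le> out_cut E (A \<inter> ?B)"
    using arc_cut_ge_min_degree(1)[of "A \<inter> ?B"] subset proper assms(3) by blast
  ultimately have *: "out_cut E (A \<inter> ?B) = \<delta>"
    "arcs_between E (A - ?B) (?B - A) = 0" "arcs_between E (?B - A) (A - ?B) = 0"
    using out_cut_submodular[OF finite_E, of A ?B] cut_act(1)[OF assms(1) subset] cut by linarith+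
  have "A \<inter> ?B \<subset> A"
  proof -
    have "\<not> A \<subseteq> ?B" using assms(2) cardB finite_A by (metis card_subset_eq finite_imageI)
    then show ?thesis by blast
  qed
  then have "\<not> 2 \<le> card (A \<inter> ?B)" using smaller_cut_gt(1)[of "A \<inter> ?B"] *(1) by linarith
  then have "card (A \<inter> ?B) = 1" using \<open>0 < card (A \<inter> ?B)\<close> by linarith
  then obtain v where v: "A \<inter> ?B = {v}" by (rule card_1_singletonE)
  show thesis using that[OF v _ *(2,3)] *(1) unfolding v .
qed

text \<open>A two-vertex \<open>A\<close> has one vertex in each part, so a vertex that returns to
  \<open>A\<close> is fixed, and by freeness all of \<open>A\<close> is. The bound leaves at least
  two vertices of \<open>A\<close> once the common one is removed.\<close>

lemma overlap_card_ge:
  assumes "\<gamma> \<in> \<Gamma>" "\<gamma> ` A \<noteq> A" "A \<inter> \<gamma> ` A \<noteq> {}"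
  shows "3 \<le> card A"
proof (rule ccontr)
  assume "\<not> 3 \<le> card A"
  moreover have "0 < card (A \<inter> V\<^sub>0)" "0 < card (A \<inter> V\<^sub>1)"
    using parts_nonempty finite_parts by (simp_all add: card_gt_0_iff)
  ultimately have "card (A \<inter> V\<^sub>0) = 1" "card (A \<inter> V\<^sub>1) = 1"
    using card_parts[OF subset] by linarith+
  then obtain a b where ab: "A \<inter> V\<^sub>0 = {a}" "A \<inter> V\<^sub>1 = {b}" by (metis card_1_singletonE)
  obtain x where x: "x \<in> A" "\<gamma> x \<in> A" using assms(3) by auto
  have "\<gamma> x = x"
  proof (cases "x \<in> V\<^sub>0")
    case True
    then have "\<gamma> x \<in> A \<inter> V\<^sub>0" "x \<in> A \<inter> V\<^sub>0" using x act_parts(1)[OF assms(1)] by auto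
    then show ?thesis unfolding ab by simp
  next
    case False
    then have "x \<in> V\<^sub>1" using x(1) subset by auto
    then have "\<gamma> x \<in> A \<inter> V\<^sub>1" "x \<in> A \<inter> V\<^sub>1" using x act_parts(2)[OF assms(1)] by auto
    then show ?thesis unfolding ab by simp
  qed
  obtain \<iota> where \<iota>: "\<iota> \<in> \<Gamma>" "\<And>v. v \<in> V \<Longrightarrow> \<iota> v = v" using act_id by blast
  have "\<gamma> y = y" if "y \<in> A" for y
  proof -
    have "x \<in> V" "y \<in> V" using x(1) that subset by auto
    then show ?thesis using act_free[OF assms(1) \<iota>(1), of x y] \<open>\<gamma> x = x\<close> \<iota>(2) by simp
  qed
  then show False using assms(2) by simp
qed

text \<open>With both cuts equal to \<delta>, posimodularity would give the two differences of
  \<open>A\<close> and its translate cuts of total at most \<open>2 * \<delta>\<close>. Each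
  difference has at least two vertices and lies properly in a superatom, so each of these cuts
  exceeds \<delta>.\<close>

lemma no_overlap_if_in_cut:
  assumes "\<gamma> \<in> \<Gamma>" "\<gamma> ` A \<noteq> A" "A \<inter> \<gamma> ` A \<noteq> {}"
  shows "in_cut E A \<noteq> \<delta>"
proof
  let ?B = "\<gamma> ` A"
  assume "in_cut E A = \<delta>"
  then have inB: "in_cut E ?B = \<delta>" using cut_act(2)[OF assms(1) subset] by simp
  interpret B: superatom V\<^sub>0 V\<^sub>1 E \<Gamma> d\<^sub>0 d\<^sub>1 ?B by (rule superatom_act[OF assms(1)])
  obtain v where v: "A \<inter> ?B = {v}" by (rule overlap[OF assms])
  then have *: "A - ?B = A - {v}" "?B - A = ?B - {v}" "v \<in> A" "v \<in> ?B" by auto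
  have "2 \<le> card (A - ?B)" "2 \<le> card (?B - A)" "A - ?B \<subset> A" "?B - A \<subset> ?B"
    using overlap_card_ge[OF assms] card_act[OF assms(1) subset] finite_A *(3,4)
    unfolding *(1,2) by auto
  then have "\<delta> < out_cut E (A - ?B)" "\<delta> < in_cut E (?B - A)"
    using smaller_cut_gt(1)[of "A - ?B"] B.smaller_cut_gt(2)[of "?B - A"] by fast+
  then show False using out_in_cut_posimodular[OF finite_E, of A ?B] cut inB by linarith
qed

text \<open>By \<open>no_overlap_if_in_cut\<close> the set \<open>A\<close> is unbalanced, which forces \<open>d\<^sub>0 < d\<^sub>1\<close> and
  \<open>|A \<inter> V\<^sub>0| = |A \<inter> V\<^sub>1| + 1\<close>, with every out-neighbour of \<open>A \<inter> V\<^sub>1\<close> in \<open>A\<close>. The stabiliser of \<open>A\<close> is then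
  transitive on \<open>A \<inter> V\<^sub>1\<close>, so that \<open>d\<^sub>1 \<le> \<delta> + 1\<close>; counting the arcs at \<open>v\<close> gives \<open>d\<^sub>1 \<ge> \<delta> + 2\<close>.\<close>

lemma no_overlap_in_part:
  assumes "\<gamma> \<in> \<Gamma>" "\<gamma> ` A \<noteq> A" "A \<inter> \<gamma> ` A = {v}" "v \<in> V\<^sub>0"
  shows False
proof -
  let ?B = "\<gamma> ` A"
  let ?e = "arcs_between E"
  let ?a\<^sub>0 = "card (A \<inter> V\<^sub>0)" and ?a\<^sub>1 = "card (A \<inter> V\<^sub>1)"
  have meet: "A \<inter> ?B \<noteq> {}" using assms(3) by simp
  have arcs: "out_cut E {v} = \<delta>" "?e (A - ?B) (?B - A) = 0" "?e (?B - A) (A - ?B) = 0"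
  proof -
    obtain x where "A \<inter> ?B = {x}" "out_cut E {x} = \<delta>"
      "?e (A - ?B) (?B - A) = 0" "?e (?B - A) (A - ?B) = 0"
      by (rule overlap[OF assms(1,2) meet])
    then show "out_cut E {v} = \<delta>" "?e (A - ?B) (?B - A) = 0" "?e (?B - A) (A - ?B) = 0"
      using assms(3) by auto
  qed
  \<comment> \<open>The out-star of the common vertex attains \<delta>, which makes the degree of
    its part the minimum one.\<close>
  have d0: "d\<^sub>0 = \<delta>" using arcs(1) out_cut_part(1)[of "{v}"] assms(4) by simp
  have in_gt: "\<delta> < in_cut E A"
    using no_overlap_if_in_cut[OF assms(1,2) meet] arc_cut_ge_min_degree(2)[OF subset proper] by linarith
  have bal: "d\<^sub>1 * ?a\<^sub>0 + d\<^sub>0 * ?a\<^sub>1 > d\<^sub>0 * ?a\<^sub>0 + d\<^sub>1 * ?a\<^sub>1"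
    using in_gt cut in_cut_balance[OF subset] out_cut_balance[OF subset] by linarith
  then have "d\<^sub>0 \<noteq> d\<^sub>1" by auto
  then have d01: "d\<^sub>0 < d\<^sub>1" using d0 by linarith
  then obtain k where k: "d\<^sub>1 = d\<^sub>0 + k" "0 < k" using less_imp_add_positive by metis
  have "?a\<^sub>1 < ?a\<^sub>0" using bal k by (simp add: algebra_simps)
  have eAA: "?e A A = ?e (A \<inter> V\<^sub>0) (A \<inter> V\<^sub>1) + ?e (A \<inter> V\<^sub>1) (A \<inter> V\<^sub>0)"
  proof -
    have "?e A A = ?e (A \<inter> V\<^sub>0) A + ?e (A \<inter> V\<^sub>1) A"
      using arcs_between_Un_left[OF finite_E Int_parts, of A A] Un_parts[OF subset] by simp
    moreover have "E \<inter> (A \<inter> V\<^sub>0) \<times> A = E \<inter> (A \<inter> V\<^sub>0) \<times> (A \<inter> V\<^sub>1)"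
      "E \<inter> (A \<inter> V\<^sub>1) \<times> A = E \<inter> (A \<inter> V\<^sub>1) \<times> (A \<inter> V\<^sub>0)"
      using arcs_bipartite disjoint_parts by blast+
    ultimately show ?thesis unfolding arcs_between_def by simp
  qed
  interpret rev: biregular_bipartite_action V\<^sub>0 V\<^sub>1 "E\<inverse>" \<Gamma> d\<^sub>1 d\<^sub>0 by (rule reverse_arcs)
  have "?e (A \<inter> V\<^sub>0) (A \<inter> V\<^sub>1) \<le> ?e UNIV (A \<inter> V\<^sub>1)"
    using finite_E by (intro arcs_between_mono) auto
  also have "\<dots> = d\<^sub>0 * ?a\<^sub>1"
    using rev.out_arcs_parts(2)[of "A \<inter> V\<^sub>1"] finite_parts by (simp add: arcs_between_converse)
  finally have e01: "?e (A \<inter> V\<^sub>0) (A \<inter> V\<^sub>1) \<le> d\<^sub>0 * ?a\<^sub>1" .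
  have "?e (A \<inter> V\<^sub>1) (A \<inter> V\<^sub>0) \<le> ?e (A \<inter> V\<^sub>1) UNIV"
    using finite_E by (intro arcs_between_mono) auto
  moreover have out1: "?e (A \<inter> V\<^sub>1) UNIV = d\<^sub>1 * ?a\<^sub>1"
    using out_arcs_parts(2)[of "A \<inter> V\<^sub>1"] finite_parts by simp
  ultimately have e10: "?e (A \<inter> V\<^sub>1) (A \<inter> V\<^sub>0) \<le> d\<^sub>1 * ?a\<^sub>1" by simp
  have tot: "d\<^sub>0 + (?e (A \<inter> V\<^sub>0) (A \<inter> V\<^sub>1) + ?e (A \<inter> V\<^sub>1) (A \<inter> V\<^sub>0)) = d\<^sub>0 * ?a\<^sub>0 + d\<^sub>1 * ?a\<^sub>1"
    using out_cut_balance[OF subset] cut d0 eAA by simp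
  \<comment> \<open>Even if every arc into or out of \<open>A \<inter> V\<^sub>1\<close> stays in
    \<open>A\<close>, the balance allows \<open>A \<inter> V\<^sub>0\<close> a surplus of at most
    one vertex.\<close>
  then have "d\<^sub>0 * ?a\<^sub>0 \<le> d\<^sub>0 * Suc ?a\<^sub>1" using e01 e10 by simp
  then have "?a\<^sub>0 \<le> Suc ?a\<^sub>1" using min_degree_pos d0 by (subst (asm) mult_le_cancel1) simp
  then have a01: "?a\<^sub>0 = Suc ?a\<^sub>1" using \<open>?a\<^sub>1 < ?a\<^sub>0\<close> by linarith
  \<comment> \<open>A surplus of exactly one turns \<open>e01\<close> and \<open>e10\<close> into
    equalities; the second says that no arc leaves \<open>A\<close> from
    \<open>A \<inter> V\<^sub>1\<close>.\<close>
  then have "?e (A \<inter> V\<^sub>1) UNIV = ?e (A \<inter> V\<^sub>1) (A \<inter> V\<^sub>0)" using tot e01 e10 out1 by simp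
  then have closed: "E \<inter> (A \<inter> V\<^sub>1) \<times> UNIV = E \<inter> (A \<inter> V\<^sub>1) \<times> (A \<inter> V\<^sub>0)"
    unfolding arcs_between_def using finite_E by (intro card_subset_eq[symmetric]) auto
  obtain w where w: "w \<in> A \<inter> V\<^sub>1" using parts_nonempty(2) by blast
  have "E `` {w} \<subseteq> A \<inter> V\<^sub>0" using closed w by blast
  then have d1_le: "d\<^sub>1 \<le> ?a\<^sub>0"
    using out_degree(2)[of w] w card_mono[of "A \<inter> V\<^sub>0" "E `` {w}"] finite_parts by auto

  \<comment> \<open>The common vertex of two distinct overlapping translates has an out-star of size
    \<delta>, whereas vertices of \<open>V\<^sub>1\<close> have out-degree
    \<open>d\<^sub>1 > \<delta>\<close>.\<close>
  have stab: "\<gamma>' ` A = A" if "\<gamma>' \<in> \<Gamma>" "\<gamma>' w \<in> A \<inter> V\<^sub>1" for \<gamma>'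
  proof (rule ccontr)
    assume ne: "\<gamma>' ` A \<noteq> A"
    have m: "\<gamma>' w \<in> A \<inter> \<gamma>' ` A" using that w by blast
    then have "A \<inter> \<gamma>' ` A \<noteq> {}" by blast
    from overlap[OF that(1) ne this]
    obtain x where x: "A \<inter> \<gamma>' ` A = {x}" "out_cut E {x} = \<delta>" by metis
    then have "out_cut E {\<gamma>' w} = \<delta>" using m unfolding x(1) by auto
    then show False using out_cut_part(2)[of "{\<gamma>' w}"] that(2) d01 d0 by simp
  qed
  have "?a\<^sub>1 \<le> out_cut E A"
  proof (rule card_le_out_cut[OF subset proper, of w])
    fix a assume a: "a \<in> A \<inter> V\<^sub>1"
    then obtain \<gamma>' where "\<gamma>' \<in> \<Gamma>" "\<gamma>' w = a" using act_transitive(2) w by blast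
    then show "\<exists>\<gamma>\<in>\<Gamma>. \<gamma> w = a \<and> \<gamma> ` A = A" using stab a by blast
  qed (use w finite_parts in auto)
  then have d1_le': "d\<^sub>1 \<le> Suc \<delta>" using d1_le a01 cut by linarith

  have *: "A - ?B = A - {v}" "?B - A = ?B - {v}" "v \<in> A" "v \<in> ?B" using assms(3) by auto
  interpret B: superatom V\<^sub>0 V\<^sub>1 E \<Gamma> d\<^sub>0 d\<^sub>1 ?B by (rule superatom_act[OF assms(1)])
  have "2 \<le> card (A - ?B)" "2 \<le> card (?B - A)" "A - ?B \<subset> A" "?B - A \<subset> ?B"
    using overlap_card_ge[OF assms(1,2) meet] card_act[OF assms(1) subset] finite_A *(3,4)
    unfolding *(1,2) by auto
  then have "\<delta> < out_cut E (A - ?B)" "\<delta> < out_cut E (?B - A)"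
    using smaller_cut_gt(1)[of "A - ?B"] B.smaller_cut_gt(1)[of "?B - A"] by fast+
  moreover note q = arcs_between_quadrants[OF finite_E, where A = A and B = ?B, unfolded assms(3)]
  have "?e {v} (A - ?B) + ?e {v} (?B - A) \<le> \<delta>" using q(4) arcs(1) by linarith
  moreover have "?e (A - ?B) {v} + ?e (?B - A) {v} \<le> d\<^sub>1"
  proof -
    have "?e (A - ?B) {v} + ?e (?B - A) {v} = ?e ((A - ?B) \<union> (?B - A)) {v}"
      by (rule arcs_between_Un_left[OF finite_E, symmetric]) auto
    also have "\<dots> \<le> ?e UNIV {v}" using finite_E by (intro arcs_between_mono) auto
    also have "\<dots> = d\<^sub>1"
      using rev.out_arcs_parts(1)[of "{v}"] assms(4) by (simp add: arcs_between_converse)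
    finally show ?thesis .
  qed
  \<comment> \<open>Let \<open>P\<close> and \<open>R\<close> be the two differences. The cuts of
    \<open>A\<close> and its translate add up to \<open>2 * \<delta>\<close>; removing the \<delta>
    arcs out of \<open>v\<close> leaves \<delta> arcs from \<open>P\<close>, \<open>R\<close> and
    \<open>v\<close> to the outside of the union. As \<open>P\<close> and \<open>R\<close> have cuts
    of at least \<open>\<delta> + 1\<close> each and no arcs between them, at least
    \<open>\<delta> + 2\<close> of their arcs end in \<open>v\<close>, whose in-degree is at most
    \<open>\<delta> + 1\<close>.\<close>
  ultimately show False
    using q(1,2,4,6,7) arcs cut B.cut d1_le' by linarith
qed

theorem superatom_block: "block A"
proof (rule ccontr)
  assume "\<not> block A"
  then obtain \<gamma> where \<gamma>: "\<gamma> \<in> \<Gamma>" "\<gamma> ` A \<noteq> A" "A \<inter> \<gamma> ` A \<noteq> {}" by blast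
  obtain v where v: "A \<inter> \<gamma> ` A = {v}" by (rule overlap[OF \<gamma>])
  interpret swap: superatom V\<^sub>1 V\<^sub>0 E \<Gamma> d\<^sub>1 d\<^sub>0 A by (rule swap_superatom)
  have "v \<in> V" using v subset by blast
  then show False
    using no_overlap_in_part[OF \<gamma>(1,2) v] swap.no_overlap_in_part[OF \<gamma>(1,2) v] by blast
qed

end

context biregular_bipartite_action
begin

text \<open>If a smallest candidate attained \<delta> by its in-cut only, it would be a superatom of
  the converse relation, hence a block meeting both parts equally. Its two cuts would then agree, so
  this case is contradictory.\<close>

theorem nontrivial_cut_block:
  assumes "A \<subseteq> V" "2 \<le> card A" "2 \<le> card (V - A)" "out_cut E A = \<delta>"
  obtains B where "B \<subseteq> V" "block B" "B \<inter> V\<^sub>0 \<noteq> {}" "B \<inter> V\<^sub>1 \<noteq> {}" "out_cut E B = \<delta>"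
proof -
  define P where "P B \<longleftrightarrow> B \<subseteq> V \<and> 2 \<le> card B \<and> 2 \<le> card (V - B) \<and> (out_cut E B = \<delta> \<or> in_cut E B = \<delta>)" for B
  have "P A" using assms unfolding P_def by simp
  then obtain B where B: "P B" "\<And>C. P C \<Longrightarrow> card B \<le> card C"
    using arg_min_nat_lemma[of P A card] by blast
  interpret rev: biregular_bipartite_action V\<^sub>0 V\<^sub>1 "E\<inverse>" \<Gamma> d\<^sub>1 d\<^sub>0 by (rule reverse_arcs)
  have min: "min d\<^sub>1 d\<^sub>0 = \<delta>" by auto
  show thesis
  proof (cases "out_cut E B = \<delta>")
    case True
    interpret B: superatom V\<^sub>0 V\<^sub>1 E \<Gamma> d\<^sub>0 d\<^sub>1 B
    proof
      show "B \<subseteq> V" "2 \<le> card B" "2 \<le> card (V - B)" "out_cut E B = \<delta>"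
        using B(1) True unfolding P_def by simp_all
      show "card B \<le> card C"
        if "C \<subseteq> V" "2 \<le> card C" "2 \<le> card (V - C)" "out_cut E C = \<delta> \<or> in_cut E C = \<delta>" for C
        by (rule B(2)) (simp only: P_def that simp_thms)
    qed
    show thesis by (rule that[OF B.subset B.superatom_block B.parts_nonempty True])
  next
    case False
    then have in_B: "in_cut E B = \<delta>" using B(1) unfolding P_def by blast
    interpret B: superatom V\<^sub>0 V\<^sub>1 "E\<inverse>" \<Gamma> d\<^sub>1 d\<^sub>0 B
    proof
      show "B \<subseteq> V" "2 \<le> card B" "2 \<le> card (V - B)" "out_cut (E\<inverse>) B = min d\<^sub>1 d\<^sub>0"
        using B(1) in_B unfolding P_def min arcs_between_converse by simp_all
      show "card B \<le> card C"
        if "C \<subseteq> V" "2 \<le> card C" "2 \<le> card (V - C)"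
          "out_cut (E\<inverse>) C = min d\<^sub>1 d\<^sub>0 \<or> in_cut (E\<inverse>) C = min d\<^sub>1 d\<^sub>0" for C
      proof (rule B(2))
        have "out_cut E C = \<delta> \<or> in_cut E C = \<delta>"
          using that(4) unfolding min arcs_between_converse by blast
        then show "P C" using that(1-3) unfolding P_def by blast
      qed
    qed
    have "out_cut E B = \<delta>"
      using block_out_cut_eq_in_cut[OF B.subset B.superatom_block B.parts_nonempty] in_B by simp
    then show thesis using False by blast
  qed
qed

end

section \<open>Minimum arc-cuts\<close>

text \<open>The set of vertices reachable from \<open>u\<close> has no leaving arc, so it is
  everything as soon as each proper nonempty set has one.\<close>

lemma strongly_connected_iff_cuts:
  fixes X :: "('v, 'v \<times> 'v) pre_digraph"
  assumes X: "tail X = fst" "head X = snd" "arcs X \<subseteq> verts X \<times> verts X"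
  shows "strongly_connected X \<longleftrightarrow> verts X \<noteq> {} \<and>
    (\<forall>A. A \<subseteq> verts X \<longrightarrow> A \<noteq> {} \<longrightarrow> A \<noteq> verts X \<longrightarrow> arcs X \<inter> A \<times> (- A) \<noteq> {})"
proof -
  have ends: "arcs_ends X = arcs X" unfolding arcs_ends_conv X(1,2) by simp
  show ?thesis
  proof (intro iffI conjI allI impI)
    fix A assume sc: "strongly_connected X" and A: "A \<subseteq> verts X" "A \<noteq> {}" "A \<noteq> verts X"
    obtain u v where uv: "u \<in> A" "v \<in> verts X" "v \<notin> A" using A by blast
    show "arcs X \<inter> A \<times> (- A) \<noteq> {}"
    proof
      assume *: "arcs X \<inter> A \<times> (- A) = {}"
      have "(u, v) \<in> rtrancl_on (verts X) (arcs X)"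
        using sc uv A unfolding strongly_connected_def reachable_def ends by blast
      then have "v \<in> A" by (induct rule: rtrancl_on_induct) (use uv(1) * in auto)
      then show False using uv(3) by simp
    qed
  next
    assume r: "verts X \<noteq> {} \<and>
      (\<forall>A. A \<subseteq> verts X \<longrightarrow> A \<noteq> {} \<longrightarrow> A \<noteq> verts X \<longrightarrow> arcs X \<inter> A \<times> (- A) \<noteq> {})"
    have "(u, v) \<in> rtrancl_on (verts X) (arcs X)" if uv: "u \<in> verts X" "v \<in> verts X" for u v
    proof -
      define A where "A = {w. (u, w) \<in> rtrancl_on (verts X) (arcs X)}"
      have "A \<subseteq> verts X" unfolding A_def by (auto dest: in_rtrancl_on_in_F)
      moreover have "u \<in> A" unfolding A_def using uv(1) by simp
      moreover have "arcs X \<inter> A \<times> (- A) = {}"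
        unfolding A_def using X(3) by (auto intro: rtrancl_on_into_rtrancl_on)
      ultimately have "A = verts X" using r by blast
      then show ?thesis using uv(2) unfolding A_def by blast
    qed
    then show "strongly_connected X"
      using r unfolding strongly_connected_def reachable_def ends by blast
  qed (simp add: strongly_connected_def)
qed

context biregular_bipartite_action
begin

context
  fixes X :: "('v, 'v \<times> 'v) pre_digraph"
  assumes verts_X: "verts X = V" and arcs_X: "arcs X = E"
    and tail_X: "tail X = fst" and head_X: "head X = snd"
    and parts_ne: "V\<^sub>0 \<noteq> {}" "V\<^sub>1 \<noteq> {}"
begin

lemma out_arcs_X: "out_arcs X v = E \<inter> {v} \<times> UNIV"
  unfolding out_arcs_def arcs_X tail_X by auto

lemma in_arcs_X: "in_arcs X v = E \<inter> UNIV \<times> {v}"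
  unfolding in_arcs_def arcs_X head_X by auto

lemma no_loops: "(v, v) \<notin> E"
  using arcs_bipartite disjoint_parts by auto

lemma out_arcs_X_cut: "out_arcs X v = E \<inter> {v} \<times> (- {v})"
  unfolding out_arcs_X using no_loops by auto

lemma in_arcs_X_cut: "v \<in> V \<Longrightarrow> in_arcs X v = E \<inter> (V - {v}) \<times> (- (V - {v}))"
  unfolding in_arcs_X using no_loops arcs_V by auto

lemma out_degree_X: "v \<in> V\<^sub>0 \<Longrightarrow> Digraph.out_degree X v = d\<^sub>0" "v \<in> V\<^sub>1 \<Longrightarrow> Digraph.out_degree X v = d\<^sub>1"
  using out_arcs_parts[of "{v}"]
  unfolding Digraph.out_degree_def out_arcs_X arcs_between_def by auto

lemma in_degree_X: "v \<in> V\<^sub>0 \<Longrightarrow> Digraph.in_degree X v = d\<^sub>1" "v \<in> V\<^sub>1 \<Longrightarrow> Digraph.in_degree X v = d\<^sub>0"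
  using biregular_bipartite_action.out_arcs_parts[OF reverse_arcs, of "{v}"]
  unfolding Digraph.in_degree_def in_arcs_X arcs_between_converse unfolding arcs_between_def by auto

lemma min_degree_X: "min_degree X = \<delta>"
proof -
  have "Digraph.out_degree X ` V\<^sub>0 = (\<lambda>_. d\<^sub>0) ` V\<^sub>0" "Digraph.out_degree X ` V\<^sub>1 = (\<lambda>_. d\<^sub>1) ` V\<^sub>1"
    "Digraph.in_degree X ` V\<^sub>0 = (\<lambda>_. d\<^sub>1) ` V\<^sub>0" "Digraph.in_degree X ` V\<^sub>1 = (\<lambda>_. d\<^sub>0) ` V\<^sub>1"
    by (auto intro!: image_cong simp: out_degree_X in_degree_X)
  then have "Digraph.out_degree X ` V = {d\<^sub>0, d\<^sub>1}" "Digraph.in_degree X ` V = {d\<^sub>0, d\<^sub>1}"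
    using parts_ne by (auto simp: image_Un)
  then show ?thesis unfolding min_degree_def verts_X by simp
qed

lemma arc_cut_X:
  "arc_cut X S \<longleftrightarrow> S \<subseteq> E \<and> (\<exists>A. A \<subseteq> V \<and> A \<noteq> {} \<and> A \<noteq> V \<and> E \<inter> A \<times> (- A) \<subseteq> S)"
proof -
  have "strongly_connected (del_arcs X S) \<longleftrightarrow>
    (\<forall>A. A \<subseteq> V \<longrightarrow> A \<noteq> {} \<longrightarrow> A \<noteq> V \<longrightarrow> (E - S) \<inter> A \<times> (- A) \<noteq> {})"
  proof -
    have "E - S \<subseteq> V \<times> V" using arcs_V by blast
    then show ?thesis
      using strongly_connected_iff_cuts[of "del_arcs X S"] parts_ne
      by (simp add: del_arcs_def verts_X arcs_X tail_X head_X)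
  qed
  moreover have "(E - S) \<inter> A \<times> (- A) = {} \<longleftrightarrow> E \<inter> A \<times> (- A) \<subseteq> S" for A by blast
  ultimately show ?thesis unfolding arc_cut_def arcs_X by blast
qed

text \<open>The out-star of a vertex in the part of smaller degree attains \<delta>; every arc-cut
  contains a directed cut, which has at least that many arcs.\<close>

lemma arc_connectivity_X: "arc_connectivity X = \<delta>"
proof -
  obtain v where v: "v \<in> V" "out_cut E {v} = \<delta>"
  proof (cases "d\<^sub>0 \<le> d\<^sub>1")
    case True
    obtain v where "v \<in> V\<^sub>0" using parts_ne by blast
    then show thesis using that[of v] out_cut_part(1)[of "{v}"] True by simp
  next
    case False
    obtain v where "v \<in> V\<^sub>1" using parts_ne by blast
    then show thesis using that[of v] out_cut_part(2)[of "{v}"] False by simp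
  qed
  obtain a b where "a \<in> V\<^sub>0" "b \<in> V\<^sub>1" using parts_ne by blast
  then have "a \<in> V" "b \<in> V" "a \<noteq> b" using disjoint_parts by auto
  then have "{v} \<noteq> V" by (metis singletonD)
  then have "arc_cut X (E \<inter> {v} \<times> (- {v}))"
    unfolding arc_cut_X using v(1) by (intro conjI exI[of _ "{v}"]) auto
  then have "\<exists>S. arc_cut X S \<and> card S = \<delta>" using v(2) unfolding arcs_between_def by blast
  moreover have "\<delta> \<le> card S" if S: "arc_cut X S" for S
  proof -
    obtain A where A: "A \<subseteq> V" "A \<noteq> {}" "A \<noteq> V" "E \<inter> A \<times> (- A) \<subseteq> S" "S \<subseteq> E"
      using S unfolding arc_cut_X by blast
    have "\<delta> \<le> out_cut E A" by (rule arc_cut_ge_min_degree(1)[OF A(1-3)])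
    also have "\<dots> \<le> card S"
      unfolding arcs_between_def using A(4,5) finite_E by (meson card_mono finite_subset)
    finally show ?thesis .
  qed
  ultimately show ?thesis unfolding arc_connectivity_def by (intro Least_equality) blast+
qed

text \<open>A minimum arc-cut contains a directed cut that already has \<delta> arcs, so the two
  coincide.\<close>

lemma min_arc_cut_X:
  "min_arc_cut X S \<longleftrightarrow> (\<exists>A. A \<subseteq> V \<and> A \<noteq> {} \<and> A \<noteq> V \<and> out_cut E A = \<delta> \<and> S = E \<inter> A \<times> (- A))"
proof
  assume S: "min_arc_cut X S"
  then obtain A where A: "A \<subseteq> V" "A \<noteq> {}" "A \<noteq> V" "E \<inter> A \<times> (- A) \<subseteq> S" "S \<subseteq> E"
    unfolding min_arc_cut_def arc_cut_X by blast
  have fin: "finite S" using A(5) finite_E by (rule finite_subset)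
  have card: "card S = \<delta>" using S unfolding min_arc_cut_def arc_connectivity_X by blast
  have ge: "\<delta> \<le> card (E \<inter> A \<times> (- A))"
    using arc_cut_ge_min_degree(1)[OF A(1-3)] unfolding arcs_between_def .
  have "S = E \<inter> A \<times> (- A)" using card_seteq[OF fin A(4)] ge card by simp
  then show "\<exists>A. A \<subseteq> V \<and> A \<noteq> {} \<and> A \<noteq> V \<and> out_cut E A = \<delta> \<and> S = E \<inter> A \<times> (- A)"
    using A(1-3) card unfolding arcs_between_def by blast
next
  assume "\<exists>A. A \<subseteq> V \<and> A \<noteq> {} \<and> A \<noteq> V \<and> out_cut E A = \<delta> \<and> S = E \<inter> A \<times> (- A)"
  then show "min_arc_cut X S"
    unfolding min_arc_cut_def arc_cut_X arc_connectivity_X arcs_between_def by blast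
qed

text \<open>The directed cut of a single vertex is its out-star, that of the complement of a vertex
  is an in-star. A minimum cut that is no star therefore has two vertices on either side.\<close>

lemma not_super_arc_connected_block:
  assumes "\<not> super_arc_connected X"
  obtains B where "B \<subseteq> V" "block B" "B \<inter> V\<^sub>0 \<noteq> {}" "B \<inter> V\<^sub>1 \<noteq> {}" "out_cut E B = \<delta>"
proof -
  obtain A where A: "A \<subseteq> V" "A \<noteq> {}" "A \<noteq> V" "out_cut E A = \<delta>"
    and star: "\<And>v. v \<in> V \<Longrightarrow> E \<inter> A \<times> (- A) \<noteq> in_arcs X v \<and> E \<inter> A \<times> (- A) \<noteq> out_arcs X v"
    using assms unfolding super_arc_connected_def min_arc_cut_X verts_X by blast
  have fin: "finite A" "finite (V - A)" using A(1) finite_V by (auto intro: finite_subset)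
  have "card A \<noteq> 1"
  proof
    assume "card A = 1"
    then obtain v where "A = {v}" by (rule card_1_singletonE)
    then show False using star[of v] A(1) out_arcs_X_cut[of v] by blast
  qed
  moreover have "card (V - A) \<noteq> 1"
  proof
    assume "card (V - A) = 1"
    then obtain v where v: "V - A = {v}" by (rule card_1_singletonE)
    then have "A = V - {v}" "v \<in> V" using A(1) by blast+
    then show False using star[of v] in_arcs_X_cut[of v] by blast
  qed
  moreover have "0 < card A" "0 < card (V - A)" using A(1-3) fin by (auto simp: card_gt_0_iff)
  ultimately have "2 \<le> card A" "2 \<le> card (V - A)" by linarith+
  then show thesis using nontrivial_cut_block[OF A(1) _ _ A(4)] that by blast
qed

text \<open>If the cut were a star, it would be the out-star of a tail inside \<open>A\<close> or
  the in-star of a head outside. The assumptions \<open>inner\<close> and \<open>outer\<close>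
  supply an arc of that star which does not cross.\<close>

lemma not_super_arc_connectedI:
  assumes "A \<subseteq> V" "A \<noteq> {}" "A \<noteq> V" "out_cut E A = \<delta>"
    and inner: "\<And>u. u \<in> A \<Longrightarrow> E `` {u} \<inter> A \<noteq> {}"
    and outer: "\<And>u. u \<in> V - A \<Longrightarrow> E\<inverse> `` {u} - A \<noteq> {}"
  shows "\<not> super_arc_connected X"
proof
  let ?S = "E \<inter> A \<times> (- A)"
  assume "super_arc_connected X"
  moreover have "min_arc_cut X ?S" unfolding min_arc_cut_X using assms(1-4) by blast
  ultimately obtain v where v: "?S = in_arcs X v \<or> ?S = out_arcs X v"
    unfolding super_arc_connected_def by blast
  have "?S \<noteq> {}" using out_cut_pos[OF assms(1-3)] unfolding arcs_between_def by auto
  then obtain x y where xy: "(x, y) \<in> ?S" by auto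
  from v show False
  proof
    assume S: "?S = in_arcs X v"
    then have "y = v" using xy unfolding in_arcs_X by auto
    moreover have "y \<in> V - A" using xy arcs_V by auto
    ultimately obtain z where "(z, v) \<in> E" "z \<notin> A" using outer by blast
    then show False using S unfolding in_arcs_X by auto
  next
    assume S: "?S = out_arcs X v"
    then have "x = v" "v \<in> A" using xy unfolding out_arcs_X by auto
    then obtain z where "(v, z) \<in> E" "z \<in> A" using inner by blast
    then show False using S unfolding out_arcs_X by auto
  qed
qed

end

end

section \<open>Directed cycles\<close>

text \<open>With one out-arc per vertex, reachability is iteration of \<open>f\<close>. Strong
  connectivity makes the vertex set the orbit of a single vertex, and the least positive return time
  is the length of the cycle.\<close>

lemma directed_cycle_functional:
  fixes X :: "('v, 'v \<times> 'v) pre_digraph"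
  assumes "strongly_connected X" "tail X = fst" "head X = snd"
    and arcs: "arcs X = {(v, f v) | v. v \<in> verts X}" and f: "f ` verts X \<subseteq> verts X"
  shows "directed_cycle X"
proof -
  have ends: "arcs_ends X = arcs X" unfolding arcs_ends_conv assms(2,3) by simp
  have orbit: "\<exists>i. v = (f ^^ i) u" if "u \<in> verts X" "v \<in> verts X" for u v
  proof -
    have "(u, v) \<in> rtrancl_on (verts X) (arcs X)"
      using assms(1) that unfolding strongly_connected_def reachable_def ends by blast
    then show ?thesis
    proof (induct rule: rtrancl_on_induct)
      case base
      show ?case by (rule exI[of _ 0]) simp
    next
      case (step y z)
      then obtain i where "y = (f ^^ i) u" by blast
      then have "z = (f ^^ Suc i) u" using step(2) unfolding arcs by simp
      then show ?case by blast
    qed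
  qed
  obtain v\<^sub>0 where v\<^sub>0: "v\<^sub>0 \<in> verts X" using assms(1) unfolding strongly_connected_def by blast
  have fv: "(f ^^ i) v\<^sub>0 \<in> verts X" for i using v\<^sub>0 f by (induct i) auto
  obtain j where "v\<^sub>0 = (f ^^ j) (f v\<^sub>0)" using orbit[of "f v\<^sub>0" v\<^sub>0] v\<^sub>0 f by blast
  then have "0 < Suc j \<and> (f ^^ Suc j) v\<^sub>0 = v\<^sub>0" by (simp add: funpow_swap1)
  then have ex: "\<exists>p. 0 < p \<and> (f ^^ p) v\<^sub>0 = v\<^sub>0" by blast
  define p where "p = (LEAST p. 0 < p \<and> (f ^^ p) v\<^sub>0 = v\<^sub>0)"
  have p: "0 < p" "(f ^^ p) v\<^sub>0 = v\<^sub>0" using LeastI_ex[OF ex] unfolding p_def by blast+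
  have p_least: "p \<le> q" if "0 < q" "(f ^^ q) v\<^sub>0 = v\<^sub>0" for q
    unfolding p_def by (rule Least_le) (use that in blast)
  define g where "g i = (f ^^ i) v\<^sub>0" for i
  have g_mod: "g (i mod p) = g i" for i unfolding g_def by (rule funpow_mod_eq[OF p(2)])
  have g_neq: "g i \<noteq> g j" if "i < j" "j < p" for i j
  proof
    assume "g i = g j"
    \<comment> \<open>Another \<open>p - j\<close> steps bring \<open>g j\<close> back to
      \<open>v\<^sub>0\<close>, so equality would mean a return after \<open>p - j + i < p\<close>
      steps.\<close>
    then have "(f ^^ (p - j)) (g i) = (f ^^ (p - j)) (g j)" by simp
    then have "(f ^^ (p - j + i)) v\<^sub>0 = (f ^^ (p - j + j)) v\<^sub>0"
      unfolding g_def funpow_add comp_apply .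
    then have "(f ^^ (p - j + i)) v\<^sub>0 = v\<^sub>0" using that p(2) by simp
    then have "p \<le> p - j + i" using that by (intro p_least) auto
    then show False using that by linarith
  qed
  have inj: "inj_on g {..<p}"
  proof (rule inj_onI)
    fix i j assume "i \<in> {..<p}" "j \<in> {..<p}" "g i = g j"
    then show "i = j" using g_neq[of i j] g_neq[of j i] by (metis lessThan_iff linorder_neqE_nat)
  qed
  have verts: "verts X = g ` {..<p}"
  proof
    show "verts X \<subseteq> g ` {..<p}"
    proof
      fix v assume "v \<in> verts X"
      then obtain i where "v = g i" using orbit[OF v\<^sub>0] unfolding g_def by blast
      then have "v = g (i mod p)" using g_mod by simp
      then show "v \<in> g ` {..<p}" using p(1) by simp
    qed
  qed (use fv g_def in auto)
  define \<phi> where "\<phi> = the_inv_into {..<p} g"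
  have \<phi>g: "\<phi> (g i) = i" if "i < p" for i
    unfolding \<phi>_def using the_inv_into_f_f[OF inj] that by simp
  have fg: "f (g i) = g (Suc i mod p)" for i using g_mod[of "Suc i"] by (simp add: g_def)
  have inj_\<phi>: "inj_on \<phi> (verts X)" unfolding verts by (rule inj_onI) (use \<phi>g in auto)
  have wf: "arcs X \<subseteq> verts X \<times> verts X" unfolding arcs using f by auto
  let ?hom = "\<lparr>iso_verts = \<phi>, iso_arcs = map_prod \<phi> \<phi>, iso_head = snd, iso_tail = fst\<rparr>"
  have "wf_digraph X" by unfold_locales (use wf assms(2,3) in auto)
  moreover have "inj_on (map_prod \<phi> \<phi>) (arcs X)"
    using map_prod_inj_on[OF inj_\<phi> inj_\<phi>] wf by (rule inj_on_subset)
  ultimately have "pre_digraph.digraph_isomorphism X ?hom"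
    unfolding pre_digraph.digraph_isomorphism_def using inj_\<phi> assms(2,3) by auto
  moreover have "\<phi> ` verts X = {..<p}" unfolding verts image_image using \<phi>g by auto
  moreover have "map_prod \<phi> \<phi> ` arcs X = {(i, Suc i mod p) | i. i < p}"
  proof -
    have "arcs X = (\<lambda>i. (g i, g (Suc i mod p))) ` {..<p}"
      unfolding arcs verts using fg by auto
    then have "map_prod \<phi> \<phi> ` arcs X = (\<lambda>i. (\<phi> (g i), \<phi> (g (Suc i mod p)))) ` {..<p}"
      by (simp add: image_image)
    also have "\<dots> = (\<lambda>i. (i, Suc i mod p)) ` {..<p}"
      using p(1) by (intro image_cong) (auto simp: \<phi>g)
    finally show ?thesis by auto
  qed
  ultimately have "digraph_iso X (with_proj (cyclic_digraph p))"
    unfolding digraph_iso_def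
    by (intro exI[of _ ?hom]) (simp add: app_iso_def with_proj_def cyclic_digraph_def)
  then show ?thesis unfolding directed_cycle_def using p(1) by (intro exI[of _ p]) simp
qed

section \<open>Bi-Cayley digraphs\<close>

text \<open>Otherwise the simplifier turns the layer tag \<open>1\<close> into \<open>Suc 0\<close>.\<close>

declare One_nat_def [simp del]

locale connected_bi_cayley = group G for G :: "('a, 'b) monoid_scheme" (structure) +
  fixes T\<^sub>0 T\<^sub>1 :: "'a set"
  assumes finite_carrier: "finite (carrier G)"
    and T\<^sub>0: "T\<^sub>0 \<subseteq> carrier G" and T\<^sub>1: "T\<^sub>1 \<subseteq> carrier G"
    and connected: "strongly_connected (bi_cayley_digraph G T\<^sub>0 T\<^sub>1)"
begin

abbreviation X :: "('a \<times> nat, ('a \<times> nat) \<times> ('a \<times> nat)) pre_digraph" where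
  "X \<equiv> bi_cayley_digraph G T\<^sub>0 T\<^sub>1"

abbreviation L\<^sub>0 :: "('a \<times> nat) set" where "L\<^sub>0 \<equiv> carrier G \<times> {0}"

abbreviation L\<^sub>1 :: "('a \<times> nat) set" where "L\<^sub>1 \<equiv> carrier G \<times> {1}"

text \<open>Arcs arise by multiplication on the left, so multiplication on the right commutes with
  them.\<close>

definition shift :: "'a \<Rightarrow> 'a \<times> nat \<Rightarrow> 'a \<times> nat" where
  "shift x p = (fst p \<otimes> x, snd p)"

lemma in_T: "t \<in> T\<^sub>0 \<Longrightarrow> t \<in> carrier G" "t \<in> T\<^sub>1 \<Longrightarrow> t \<in> carrier G"
  using T\<^sub>0 T\<^sub>1 by auto

lemma finite_T: "finite T\<^sub>0" "finite T\<^sub>1"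
  using T\<^sub>0 T\<^sub>1 finite_carrier by (auto intro: finite_subset)

lemma X_simps: "verts X = L\<^sub>0 \<union> L\<^sub>1" "tail X = fst" "head X = snd"
  unfolding bi_cayley_digraph_def by auto

lemma arcs_X_iff:
  "((g, 0), (u, 1)) \<in> arcs X \<longleftrightarrow> g \<in> carrier G \<and> (\<exists>t\<in>T\<^sub>0. u = t \<otimes> g)"
  "((u, 1), (g, 0)) \<in> arcs X \<longleftrightarrow> g \<in> carrier G \<and> (\<exists>t\<in>T\<^sub>1. u = t \<otimes> g)"
  unfolding bi_cayley_digraph_def by auto

lemma arcs_X_cases:
  assumes "e \<in> arcs X"
  obtains g t where "g \<in> carrier G" "t \<in> T\<^sub>0" "e = ((g, 0), (t \<otimes> g, 1))"
  | g t where "g \<in> carrier G" "t \<in> T\<^sub>1" "e = ((t \<otimes> g, 1), (g, 0))"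
  using assms unfolding bi_cayley_digraph_def by auto

lemma arcs_X_inv:
  "\<lbrakk>u \<in> carrier G; t \<in> T\<^sub>0\<rbrakk> \<Longrightarrow> ((inv t \<otimes> u, 0), (u, 1)) \<in> arcs X"
  "\<lbrakk>u \<in> carrier G; t \<in> T\<^sub>1\<rbrakk> \<Longrightarrow> ((u, 1), (inv t \<otimes> u, 0)) \<in> arcs X"
  using in_T by (auto simp: arcs_X_iff m_assoc[symmetric] intro!: bexI[of _ t])

lemma neighbours:
  assumes "u \<in> carrier G"
  shows "arcs X `` {(u, 0)} = (\<lambda>t. (t \<otimes> u, 1)) ` T\<^sub>0"
    and "(arcs X)\<inverse> `` {(u, 0)} = (\<lambda>t. (t \<otimes> u, 1)) ` T\<^sub>1"
    and "arcs X `` {(u, 1)} = (\<lambda>t. (inv t \<otimes> u, 0)) ` T\<^sub>1"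
    and "(arcs X)\<inverse> `` {(u, 1)} = (\<lambda>t. (inv t \<otimes> u, 0)) ` T\<^sub>0"
proof -
  have *: "inv t \<otimes> (t \<otimes> g) = g" if "t \<in> carrier G" "g \<in> carrier G" for t g
    using that by (simp add: m_assoc[symmetric])
  show "arcs X `` {(u, 0)} = (\<lambda>t. (t \<otimes> u, 1)) ` T\<^sub>0"
    using assms by (auto elim!: arcs_X_cases simp: arcs_X_iff)
  show "(arcs X)\<inverse> `` {(u, 0)} = (\<lambda>t. (t \<otimes> u, 1)) ` T\<^sub>1"
    using assms by (auto elim!: arcs_X_cases simp: arcs_X_iff)
  show "arcs X `` {(u, 1)} = (\<lambda>t. (inv t \<otimes> u, 0)) ` T\<^sub>1"
  proof
    show "arcs X `` {(u, 1)} \<subseteq> (\<lambda>t. (inv t \<otimes> u, 0)) ` T\<^sub>1"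
      by (auto elim!: arcs_X_cases simp: image_iff) (metis * in_T)
  qed (use arcs_X_inv(2)[OF assms] in auto)
  show "(arcs X)\<inverse> `` {(u, 1)} = (\<lambda>t. (inv t \<otimes> u, 0)) ` T\<^sub>0"
  proof
    show "(arcs X)\<inverse> `` {(u, 1)} \<subseteq> (\<lambda>t. (inv t \<otimes> u, 0)) ` T\<^sub>0"
      by (auto elim!: arcs_X_cases simp: image_iff) (metis * in_T)
  qed (use arcs_X_inv(1)[OF assms] in auto)
qed

lemma inj_on_translate:
  assumes "u \<in> carrier G" "T \<subseteq> carrier G"
  shows "inj_on (\<lambda>t. (t \<otimes> u, n)) T" and "inj_on (\<lambda>t. (inv t \<otimes> u, n)) T"
proof -
  show "inj_on (\<lambda>t. (t \<otimes> u, n)) T"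
    using assms by (auto intro!: inj_onI simp: subset_iff)
  show "inj_on (\<lambda>t. (inv t \<otimes> u, n)) T"
  proof (rule inj_onI)
    fix s t assume st: "s \<in> T" "t \<in> T" "(inv s \<otimes> u, n) = (inv t \<otimes> u, n)"
    then have c: "s \<in> carrier G" "t \<in> carrier G" using assms(2) by auto
    then have "inv s = inv t" using st(3) assms(1) by auto
    then show "s = t" using c by (metis inv_inv)
  qed
qed

lemma shift_image:
  assumes "x \<in> carrier G"
  shows "shift x ` (carrier G \<times> {n}) = carrier G \<times> {n}"
proof
  show "carrier G \<times> {n} \<subseteq> shift x ` (carrier G \<times> {n})"
  proof
    fix p assume p: "p \<in> carrier G \<times> {n}"
    then have "p = shift x (fst p \<otimes> inv x, n)" using assms by (auto simp: shift_def m_assoc)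
    then show "p \<in> shift x ` (carrier G \<times> {n})" using p assms by auto
  qed
qed (use assms in \<open>auto simp: shift_def\<close>)

text \<open>Each of \<open>T\<^sub>0\<close> and \<open>T\<^sub>1\<close> labels the arcs of one
  direction, so it gives the out-degree of one layer and the in-degree of the other. Cancellation
  yields freeness, and strong connectivity the positive cuts.\<close>

sublocale action: biregular_bipartite_action L\<^sub>0 L\<^sub>1 "arcs X" "shift ` carrier G" "card T\<^sub>0" "card T\<^sub>1"
proof
  show "finite L\<^sub>0" "finite L\<^sub>1" using finite_carrier by auto
  show "L\<^sub>0 \<inter> L\<^sub>1 = {}" by auto
  show bip: "arcs X \<subseteq> L\<^sub>0 \<times> L\<^sub>1 \<union> L\<^sub>1 \<times> L\<^sub>0"
    using in_T by (auto elim!: arcs_X_cases)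
  show "card (arcs X `` {u}) = card T\<^sub>0" "card ((arcs X)\<inverse> `` {u}) = card T\<^sub>1" if "u \<in> L\<^sub>0" for u
    using that T\<^sub>0 T\<^sub>1 by (auto simp: neighbours card_image inj_on_translate)
  show "card (arcs X `` {u}) = card T\<^sub>1" "card ((arcs X)\<inverse> `` {u}) = card T\<^sub>0" if "u \<in> L\<^sub>1" for u
    using that T\<^sub>0 T\<^sub>1 by (auto simp: neighbours card_image inj_on_translate)
  show "0 < out_cut (arcs X) A" if "A \<subseteq> L\<^sub>0 \<union> L\<^sub>1" "A \<noteq> {}" "A \<noteq> L\<^sub>0 \<union> L\<^sub>1" for A
  proof -
    have sub: "arcs X \<subseteq> verts X \<times> verts X" unfolding X_simps using bip by blast
    then have "arcs X \<inter> A \<times> (- A) \<noteq> {}"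
      using strongly_connected_iff_cuts[OF X_simps(2,3)] connected that unfolding X_simps by blast
    moreover have "finite (arcs X)"
      using sub by (rule finite_subset) (simp add: X_simps finite_carrier)
    ultimately show ?thesis unfolding arcs_between_def by (simp add: card_gt_0_iff)
  qed
  show "\<gamma> ` L\<^sub>0 = L\<^sub>0" "\<gamma> ` L\<^sub>1 = L\<^sub>1" if "\<gamma> \<in> shift ` carrier G" for \<gamma>
    using that shift_image by auto
  show "(\<gamma> u, \<gamma> v) \<in> arcs X" if "\<gamma> \<in> shift ` carrier G" "(u, v) \<in> arcs X" for \<gamma> u v
    using that in_T by (auto elim!: arcs_X_cases simp: shift_def arcs_X_iff m_assoc)
  show "\<exists>\<gamma>\<in>shift ` carrier G. \<forall>v\<in>L\<^sub>0 \<union> L\<^sub>1. \<gamma> v = v"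
    by (intro bexI[of _ "shift \<one>"]) (auto simp: shift_def)
  show "\<gamma> v = \<gamma>' v"
    if "\<gamma> \<in> shift ` carrier G" "\<gamma>' \<in> shift ` carrier G" "u \<in> L\<^sub>0 \<union> L\<^sub>1" "\<gamma> u = \<gamma>' u" "v \<in> L\<^sub>0 \<union> L\<^sub>1" for \<gamma> \<gamma>' u v
    using that by (auto simp: shift_def)
  have tr: "\<exists>\<gamma>\<in>shift ` carrier G. \<gamma> u = v" if "u \<in> carrier G \<times> {n}" "v \<in> carrier G \<times> {n}" for u v n
    using that by (intro bexI[of _ "shift (inv (fst u) \<otimes> fst v)"])
      (auto simp: shift_def m_assoc[symmetric])
  show "\<exists>\<gamma>\<in>shift ` carrier G. \<gamma> u = v" if "u \<in> L\<^sub>0" "v \<in> L\<^sub>0" for u v using tr that by blast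
  show "\<exists>\<gamma>\<in>shift ` carrier G. \<gamma> u = v" if "u \<in> L\<^sub>1" "v \<in> L\<^sub>1" for u v using tr that by blast
qed

lemma layers_nonempty: "L\<^sub>0 \<noteq> {}" "L\<^sub>1 \<noteq> {}"
  by auto

lemmas min_degree = action.min_degree_X[OF X_simps(1) refl X_simps(2,3) layers_nonempty]

text \<open>A whole layer is a proper set, so its cut, which has
  \<open>card T\<^sub>0 * card L\<^sub>0\<close> or \<open>card T\<^sub>1 * card L\<^sub>1\<close>
  arcs, is positive.\<close>

lemma T_nonempty: "T\<^sub>0 \<noteq> {}" "T\<^sub>1 \<noteq> {}"
proof -
  have mem: "(\<one>, 0) \<in> L\<^sub>0" "(\<one>, 1) \<in> L\<^sub>1" "(\<one>, 1) \<notin> L\<^sub>0" "(\<one>, 0) \<notin> L\<^sub>1" by auto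
  then have ne: "L\<^sub>0 \<noteq> L\<^sub>0 \<union> L\<^sub>1" "L\<^sub>1 \<noteq> L\<^sub>0 \<union> L\<^sub>1" by blast+
  have "0 < card T\<^sub>0 * card L\<^sub>0"
    using action.out_cut_pos[OF Un_upper1 layers_nonempty(1) ne(1)]
    unfolding action.out_cut_part(1)[OF order_refl] .
  moreover have "0 < card T\<^sub>1 * card L\<^sub>1"
    using action.out_cut_pos[OF Un_upper2 layers_nonempty(2) ne(2)]
    unfolding action.out_cut_part(2)[OF order_refl] .
  ultimately show "T\<^sub>0 \<noteq> {}" "T\<^sub>1 \<noteq> {}" by auto
qed

section \<open>Left cosets and their cuts\<close>

lemma l_coset_iff:
  assumes "c \<in> carrier G" "u \<in> carrier G" "subgroup K G"
  shows "u \<in> c <# K \<longleftrightarrow> inv c \<otimes> u \<in> K"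
proof
  assume "u \<in> c <# K"
  then obtain k where "k \<in> K" "u = c \<otimes> k" unfolding l_coset_def by auto
  then show "inv c \<otimes> u \<in> K"
    using assms subgroup.mem_carrier[OF assms(3)] by (simp add: m_assoc[symmetric])
next
  assume "inv c \<otimes> u \<in> K"
  moreover have "u = c \<otimes> (inv c \<otimes> u)" using assms by (simp add: m_assoc[symmetric])
  ultimately show "u \<in> c <# K" unfolding l_coset_def by blast
qed

lemma l_coset_iff':
  assumes "c \<in> carrier G" "u \<in> carrier G" "subgroup K G"
  shows "u \<in> c <# K \<longleftrightarrow> inv u \<otimes> c \<in> K"
proof -
  have "inv (inv c \<otimes> u) = inv u \<otimes> c" "inv (inv u \<otimes> c) = inv c \<otimes> u"
    using assms by (simp_all add: inv_mult_group)
  then show ?thesis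
    unfolding l_coset_iff[OF assms] using subgroup.m_inv_closed[OF assms(3)] by metis
qed

text \<open>Translations multiply on the right, so the orbit of \<open>c\<close> under translation
  by \<open>K\<close> is the left coset. The part in layer 0 is \<open>K\<close> itself because
  blocks are normalised to contain \<open>(\<one>, 0)\<close>.\<close>

definition coset_pair :: "'a set \<Rightarrow> 'a \<Rightarrow> ('a \<times> nat) set" where
  "coset_pair K c = K \<times> {0} \<union> (c <# K) \<times> {1}"

context
  fixes K c assumes K: "subgroup K G" and c: "c \<in> carrier G"
begin

lemma in_K: "k \<in> K \<Longrightarrow> k \<in> carrier G"
  using subgroup.mem_carrier[OF K] .

lemma in_coset: "u \<in> c <# K \<Longrightarrow> u \<in> carrier G"
  using in_K c unfolding l_coset_def by auto

text \<open>Whether an arc from \<open>(k, 0)\<close> stays in the coset pair depends only on its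
  label \<open>t\<close>; this is why the cut becomes a product.\<close>

lemma coset_mult_iff:
  assumes "t \<in> carrier G" "k \<in> K"
  shows "t \<otimes> k \<in> c <# K \<longleftrightarrow> t \<in> c <# K"
proof -
  have kc: "k \<in> carrier G" by (rule in_K[OF assms(2)])
  have "inv c \<otimes> (t \<otimes> k) = (inv c \<otimes> t) \<otimes> k" using c assms(1) kc by (simp add: m_assoc)
  moreover have "(inv c \<otimes> t) \<otimes> k \<in> K \<longleftrightarrow> inv c \<otimes> t \<in> K"
  proof
    assume "(inv c \<otimes> t) \<otimes> k \<in> K"
    then have "(inv c \<otimes> t) \<otimes> k \<otimes> inv k \<in> K"
      using assms(2) K by (simp add: subgroup.m_closed subgroup.m_inv_closed)
    then show "inv c \<otimes> t \<in> K" using c assms(1) kc by (simp add: m_assoc)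
  qed (use assms(2) K in \<open>simp add: subgroup.m_closed\<close>)
  ultimately show ?thesis
    using l_coset_iff[OF c _ K] assms(1) kc by simp
qed

text \<open>Here the label is fixed in the coset and the vertex varies: arcs with such a label never
  cross the boundary of the coset pair, in either direction.\<close>

lemma coset_inv_mult_iff:
  assumes "t \<in> carrier G" "u \<in> carrier G" "t \<in> c <# K"
  shows "inv t \<otimes> u \<in> K \<longleftrightarrow> u \<in> c <# K"
proof -
  have u: "u = t \<otimes> (inv t \<otimes> u)" using assms by (simp add: m_assoc[symmetric])
  have *: "inv t \<otimes> c \<in> K" using l_coset_iff'[OF c assms(1) K] assms(3) by simp
  have "inv t \<otimes> u = (inv t \<otimes> c) \<otimes> (inv c \<otimes> u)"
    using assms c by (simp add: m_assoc[symmetric]) (simp add: m_assoc)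
  then have "inv t \<otimes> u \<in> K" if "u \<in> c <# K"
    using * that l_coset_iff[OF c assms(2) K] subgroup.m_closed[OF K] by simp
  moreover have "u \<in> c <# K" if "inv t \<otimes> u \<in> K"
    using coset_mult_iff[OF assms(1) that] u assms(3) by simp
  ultimately show ?thesis by blast
qed

text \<open>Counterpart of \<open>coset_mult_iff\<close> for the arc with label \<open>t\<close>
  from \<open>(u, 1)\<close> to \<open>(inv t \<otimes> u, 0)\<close>: again only the label
  decides.\<close>

lemma coset_inv_mult_iff':
  assumes "t \<in> carrier G" "u \<in> c <# K"
  shows "inv t \<otimes> u \<in> K \<longleftrightarrow> t \<in> c <# K"
proof
  assume k: "inv t \<otimes> u \<in> K"
  have "u = t \<otimes> (inv t \<otimes> u)" using assms in_coset by (simp add: m_assoc[symmetric])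
  then show "t \<in> c <# K" using coset_mult_iff[OF assms(1) k] assms(2) by simp
next
  assume "t \<in> c <# K"
  then show "inv t \<otimes> u \<in> K" using coset_inv_mult_iff[OF assms(1) in_coset] assms(2) by simp
qed

lemma finite_K: "finite K" "finite (c <# K)"
  using in_K in_coset finite_carrier by (auto intro: finite_subset)

lemma card_coset: "card (c <# K) = card K"
proof -
  have "c <# K = (\<lambda>k. c \<otimes> k) ` K" unfolding l_coset_def by auto
  moreover have "inj_on (\<lambda>k. c \<otimes> k) K" using c in_K by (auto intro!: inj_onI)
  ultimately show ?thesis by (simp add: card_image)
qed

lemma coset_pair_subset: "coset_pair K c \<subseteq> L\<^sub>0 \<union> L\<^sub>1"
  unfolding coset_pair_def using in_K in_coset by auto

text \<open>An arc from the pair is determined by its tail and its label and leaves exactly when the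
  label lies outside the coset; each layer contributes \<open>card K\<close> tails.\<close>

lemma out_cut_coset_pair:
  "out_cut (arcs X) (coset_pair K c) = card K * (card (T\<^sub>0 - (c <# K)) + card (T\<^sub>1 - (c <# K)))"
proof -
  let ?A = "coset_pair K c"
  let ?f = "\<lambda>(k, t). ((k, 0::nat), (t \<otimes> k, 1::nat))"
  let ?f' = "\<lambda>(u, t). ((u, 1::nat), (inv t \<otimes> u, 0::nat))"
  let ?S = "?f ` (K \<times> (T\<^sub>0 - (c <# K)))" and ?S' = "?f' ` ((c <# K) \<times> (T\<^sub>1 - (c <# K)))"
  have "arcs X \<inter> ?A \<times> (- ?A) = ?S \<union> ?S'"
  proof
    show "arcs X \<inter> ?A \<times> (- ?A) \<subseteq> ?S \<union> ?S'"
    proof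
      fix e assume e: "e \<in> arcs X \<inter> ?A \<times> (- ?A)"
      then have "e \<in> arcs X" by blast
      then show "e \<in> ?S \<union> ?S'"
      proof (cases rule: arcs_X_cases)
        case (1 g t)
        then have "g \<in> K" "t \<otimes> g \<notin> c <# K" using e unfolding coset_pair_def by auto
        then have "(g, t) \<in> K \<times> (T\<^sub>0 - (c <# K))" using 1 coset_mult_iff[of t g] in_T by simp
        then show ?thesis using 1(3) by (auto intro!: image_eqI[of _ _ "(g, t)"])
      next
        case (2 g t)
        have u: "t \<otimes> g \<in> c <# K" "g \<notin> K" using e 2 unfolding coset_pair_def by auto
        have g: "inv t \<otimes> (t \<otimes> g) = g" using 2 in_T by (simp add: m_assoc[symmetric])
        have "t \<notin> c <# K" using coset_inv_mult_iff'[of t, OF _ u(1)] g u(2) in_T(2)[OF 2(2)] by simp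
        then have "(t \<otimes> g, t) \<in> (c <# K) \<times> (T\<^sub>1 - (c <# K))" using 2 u by simp
        moreover have "e = ?f' (t \<otimes> g, t)" using 2(3) g by simp
        ultimately show ?thesis by blast
      qed
    qed
    show "?S \<union> ?S' \<subseteq> arcs X \<inter> ?A \<times> (- ?A)"
    proof (intro Un_least image_subsetI)
      fix p assume "p \<in> K \<times> (T\<^sub>0 - (c <# K))"
      then obtain k t where p: "p = (k, t)" "k \<in> K" "t \<in> T\<^sub>0" "t \<notin> c <# K" by auto
      then have "t \<otimes> k \<notin> c <# K" using coset_mult_iff in_T by simp
      then show "?f p \<in> arcs X \<inter> ?A \<times> (- ?A)"
        using p in_K arcs_X_iff(1) unfolding coset_pair_def by auto
    next
      fix p assume "p \<in> (c <# K) \<times> (T\<^sub>1 - (c <# K))"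
      then obtain u t where p: "p = (u, t)" "u \<in> c <# K" "t \<in> T\<^sub>1" "t \<notin> c <# K" by auto
      then have "inv t \<otimes> u \<notin> K" using coset_inv_mult_iff' in_T by simp
      then show "?f' p \<in> arcs X \<inter> ?A \<times> (- ?A)"
        using p in_coset arcs_X_inv(2) unfolding coset_pair_def by auto
    qed
  qed
  moreover have "?S \<inter> ?S' = {}" by auto
  moreover have "card ?S = card K * card (T\<^sub>0 - (c <# K))"
  proof -
    have "inj_on ?f (K \<times> (T\<^sub>0 - (c <# K)))" using in_K in_T by (auto intro!: inj_onI)
    then show ?thesis by (simp add: card_image card_cartesian_product)
  qed
  moreover have "card ?S' = card K * card (T\<^sub>1 - (c <# K))"
  proof -
    have "inj_on ?f' ((c <# K) \<times> (T\<^sub>1 - (c <# K)))"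
    proof (rule inj_onI)
      fix p q assume pq: "p \<in> (c <# K) \<times> (T\<^sub>1 - (c <# K))" "q \<in> (c <# K) \<times> (T\<^sub>1 - (c <# K))" "?f' p = ?f' q"
      obtain u t t' where *: "p = (u, t)" "q = (u, t')" using pq by (cases p; cases q) auto
      have t: "t \<in> carrier G" "t' \<in> carrier G" using pq in_T unfolding * by auto
      then have "inv t = inv t'" using pq in_coset unfolding * by auto
      then have "t = t'" using t by (metis inv_inv)
      then show "p = q" unfolding * by simp
    qed
    then show ?thesis by (simp add: card_image card_cartesian_product card_coset)
  qed
  moreover have "finite ?S" "finite ?S'" using finite_K finite_T by auto
  ultimately show ?thesis
    unfolding arcs_between_def by (simp add: card_Un_disjoint distrib_left)
qed

text \<open>Arcs with a label in the coset do not cross the boundary. One such label from each of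
  \<open>T\<^sub>0\<close> and \<open>T\<^sub>1\<close> gives every inner vertex an inner
  out-neighbour and every outer vertex an outer in-neighbour.\<close>

lemma not_super_coset_pair:
  assumes "T\<^sub>0 \<inter> (c <# K) \<noteq> {}" "T\<^sub>1 \<inter> (c <# K) \<noteq> {}"
    and size: "card K * (card (T\<^sub>0 - (c <# K)) + card (T\<^sub>1 - (c <# K))) = min (card T\<^sub>0) (card T\<^sub>1)"
  shows "\<not> super_arc_connected X"
proof (rule action.not_super_arc_connectedI[OF X_simps(1) refl X_simps(2,3) layers_nonempty])
  let ?A = "coset_pair K c"
  obtain t\<^sub>0 t\<^sub>1 where t: "t\<^sub>0 \<in> T\<^sub>0" "t\<^sub>0 \<in> c <# K" "t\<^sub>1 \<in> T\<^sub>1" "t\<^sub>1 \<in> c <# K"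
    using assms(1,2) by blast
  have tc: "t\<^sub>0 \<in> carrier G" "t\<^sub>1 \<in> carrier G" using t in_T by auto
  show "?A \<subseteq> L\<^sub>0 \<union> L\<^sub>1" by (rule coset_pair_subset)
  show "?A \<noteq> {}" using subgroup.one_closed[OF K] unfolding coset_pair_def by blast
  show cut: "out_cut (arcs X) ?A = min (card T\<^sub>0) (card T\<^sub>1)"
    unfolding out_cut_coset_pair by (rule size)
  show "?A \<noteq> L\<^sub>0 \<union> L\<^sub>1"
  proof
    assume "?A = L\<^sub>0 \<union> L\<^sub>1"
    then have "arcs X \<inter> ?A \<times> (- ?A) = {}" using action.arcs_V by blast
    then have "min (card T\<^sub>0) (card T\<^sub>1) = 0" using cut unfolding arcs_between_def by simp
    moreover have "0 < card T\<^sub>0" "0 < card T\<^sub>1" using t finite_T by (auto simp: card_gt_0_iff)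
    ultimately show False by linarith
  qed
  fix p
  show "arcs X `` {p} \<inter> ?A \<noteq> {}" if p: "p \<in> ?A"
  proof -
    from p consider k where "k \<in> K" "p = (k, 0)" | u where "u \<in> c <# K" "p = (u, 1)"
      unfolding coset_pair_def by auto
    then show ?thesis
    proof cases
      case 1
      then have "(t\<^sub>0 \<otimes> k, 1) \<in> arcs X `` {p} \<inter> ?A"
        using t tc in_K coset_mult_iff[of t\<^sub>0 k] by (auto simp: arcs_X_iff coset_pair_def)
      then show ?thesis by blast
    next
      case 2
      then have "(inv t\<^sub>1 \<otimes> u, 0) \<in> arcs X `` {p} \<inter> ?A"
        using t tc in_coset coset_inv_mult_iff[of t\<^sub>1 u] arcs_X_inv(2)[of u t\<^sub>1]
        by (auto simp: coset_pair_def)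
      then show ?thesis by blast
    qed
  qed
  show "(arcs X)\<inverse> `` {p} - ?A \<noteq> {}" if p: "p \<in> L\<^sub>0 \<union> L\<^sub>1 - ?A"
  proof -
    from p consider g where "g \<in> carrier G" "g \<notin> K" "p = (g, 0)"
      | u where "u \<in> carrier G" "u \<notin> c <# K" "p = (u, 1)"
      unfolding coset_pair_def by auto
    then show ?thesis
    proof cases
      case 1
      have "inv t\<^sub>1 \<otimes> (t\<^sub>1 \<otimes> g) = g" using 1 tc by (simp add: m_assoc[symmetric])
      then have "t\<^sub>1 \<otimes> g \<notin> c <# K" using coset_inv_mult_iff[of t\<^sub>1 "t\<^sub>1 \<otimes> g"] t tc 1 by simp
      then have "(t\<^sub>1 \<otimes> g, 1) \<in> (arcs X)\<inverse> `` {p} - ?A"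
        using t 1 by (auto simp: arcs_X_iff coset_pair_def)
      then show ?thesis by blast
    next
      case 2
      then have "(inv t\<^sub>0 \<otimes> u, 0) \<in> (arcs X)\<inverse> `` {p} - ?A"
        using t tc coset_inv_mult_iff[of t\<^sub>0 u] arcs_X_inv(1)[of u t\<^sub>0]
        by (auto simp: coset_pair_def)
      then show ?thesis by blast
    qed
  qed
qed

end

lemma shift_shift:
  assumes "B \<subseteq> L\<^sub>0 \<union> L\<^sub>1" "x \<in> carrier G" "y \<in> carrier G"
  shows "shift x ` shift y ` B = shift (y \<otimes> x) ` B"
  unfolding image_image using assms by (intro image_cong) (auto simp: shift_def m_assoc)

lemma shift_one: "B \<subseteq> L\<^sub>0 \<union> L\<^sub>1 \<Longrightarrow> shift \<one> ` B = B"
  by (force simp: shift_def image_iff)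

lemma shift_block:
  assumes "B \<subseteq> L\<^sub>0 \<union> L\<^sub>1" "action.block B" "y \<in> carrier G"
  shows "action.block (shift y ` B)"
proof (intro ballI disjCI)
  fix \<gamma> assume "\<gamma> \<in> shift ` carrier G" and meet: "shift y ` B \<inter> \<gamma> ` shift y ` B \<noteq> {}"
  then obtain x where x: "x \<in> carrier G" "\<gamma> = shift x" by blast
  \<comment> \<open>Conjugation: translating by \<open>y\<close> and then by \<open>x\<close> equals
    translating by \<open>?z\<close> and then by \<open>y\<close>.\<close>
  let ?z = "y \<otimes> x \<otimes> inv y"
  have z: "?z \<in> carrier G" using x assms(3) by simp
  have eq: "\<gamma> ` shift y ` B = shift y ` shift ?z ` B"
    using shift_shift[OF assms(1), of x y] shift_shift[OF assms(1), of y ?z] x assms(3)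
    by (simp add: m_assoc)
  obtain b\<^sub>1 b\<^sub>2 where b: "b\<^sub>1 \<in> B" "b\<^sub>2 \<in> shift ?z ` B" "shift y b\<^sub>1 = shift y b\<^sub>2"
    using meet unfolding eq by blast
  have "shift ?z ` B \<subseteq> L\<^sub>0 \<union> L\<^sub>1" using action.act_subset[of "shift ?z" B] assms z by blast
  moreover have "inj_on (shift y) (L\<^sub>0 \<union> L\<^sub>1)" using assms(3) by (intro action.act_inj) blast
  ultimately have "b\<^sub>1 = b\<^sub>2" using b assms(1) by (meson inj_onD subsetD)
  then have "shift ?z ` B = B" using assms(2) b z by blast
  then show "\<gamma> ` shift y ` B = shift y ` B" unfolding eq by simp
qed

text \<open>Since \<open>(\<one>, 0)\<close> lies in the block, \<open>x\<close> stabilises it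
  exactly when \<open>(x, 0)\<close> does so too. Hence the part in layer 0 is the stabiliser, a
  subgroup, and the part in layer 1 is the orbit of \<open>(c, 1)\<close> under it.\<close>

lemma block_coset_pair:
  assumes B: "B \<subseteq> L\<^sub>0 \<union> L\<^sub>1" "action.block B" "(\<one>, 0) \<in> B" "(c, 1) \<in> B"
  obtains K where "subgroup K G" "B = coset_pair K c"
proof -
  define K where "K = {x \<in> carrier G. (x, 0) \<in> B}"
  have c: "c \<in> carrier G" using B by auto
  have stab: "(shift x p \<in> B) \<longleftrightarrow> shift x ` B = B" if "x \<in> carrier G" "p \<in> B" for x p
    using B(2) that by blast
  have K_iff: "x \<in> K \<longleftrightarrow> shift x ` B = B" if "x \<in> carrier G" for x
    using stab[OF that B(3)] that unfolding K_def by (simp add: shift_def)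
  have K: "subgroup K G"
  proof
    show "K \<subseteq> carrier G" unfolding K_def by blast
    show "\<one> \<in> K" unfolding K_def using B(3) by simp
    fix x y assume "x \<in> K" "y \<in> K"
    then have xy: "x \<in> carrier G" "y \<in> carrier G" unfolding K_def by auto
    then show "x \<otimes> y \<in> K"
      using \<open>x \<in> K\<close> \<open>y \<in> K\<close> shift_shift[OF B(1), of y x] by (simp add: K_iff)
  next
    fix x assume "x \<in> K"
    then have x: "x \<in> carrier G" unfolding K_def by auto
    then have "shift (inv x) ` shift x ` B = B"
      using shift_shift[OF B(1), of "inv x" x] shift_one[OF B(1)] by simp
    then show "inv x \<in> K" using x \<open>x \<in> K\<close> by (simp add: K_iff)
  qed
  have one: "(u, 1) \<in> B \<longleftrightarrow> u \<in> c <# K" if u: "u \<in> carrier G" for u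
  proof -
    let ?x = "inv c \<otimes> u"
    have x: "?x \<in> carrier G" using c u by simp
    have "shift ?x (c, 1) = (u, 1)" using c u by (simp add: shift_def m_assoc[symmetric])
    then have "(u, 1) \<in> B \<longleftrightarrow> ?x \<in> K" using stab[OF x B(4)] K_iff[OF x] by simp
    then show ?thesis using l_coset_iff[OF c u K] by simp
  qed
  have "B = coset_pair K c"
  proof (intro equalityI subsetI)
    fix p assume "p \<in> B"
    moreover have "p \<in> L\<^sub>0 \<union> L\<^sub>1" using \<open>p \<in> B\<close> B(1) by blast
    ultimately show "p \<in> coset_pair K c" using one unfolding coset_pair_def K_def by auto
  next
    fix p assume "p \<in> coset_pair K c"
    then show "p \<in> B" using one in_coset[OF K c] unfolding coset_pair_def K_def by auto
  qed
  then show thesis using that K by blast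
qed

lemma not_super_cosets:
  assumes "\<not> super_arc_connected X"
  obtains K c where "subgroup K G" "c \<in> carrier G"
    "card K * (card (T\<^sub>0 - (c <# K)) + card (T\<^sub>1 - (c <# K))) = min (card T\<^sub>0) (card T\<^sub>1)"
proof -
  obtain B where B: "B \<subseteq> L\<^sub>0 \<union> L\<^sub>1" "action.block B" "B \<inter> L\<^sub>0 \<noteq> {}" "B \<inter> L\<^sub>1 \<noteq> {}"
    "out_cut (arcs X) B = min (card T\<^sub>0) (card T\<^sub>1)"
    by (rule action.not_super_arc_connected_block
        [OF X_simps(1) refl X_simps(2,3) layers_nonempty assms])
  obtain g u where gu: "g \<in> carrier G" "(g, 0) \<in> B" "u \<in> carrier G" "(u, 1) \<in> B"
    using B(3,4) by blast
  \<comment> \<open>Translation by \<open>inv g\<close> moves the chosen vertex of layer 0 to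
    \<open>(\<one>, 0)\<close>, as \<open>block_coset_pair\<close> requires.\<close>
  let ?B = "shift (inv g) ` B"
  have ig: "inv g \<in> carrier G" using gu by simp
  have sub: "?B \<subseteq> L\<^sub>0 \<union> L\<^sub>1" using action.act_subset[of "shift (inv g)" B] B(1) ig by blast
  have "shift (inv g) (g, 0) = (\<one>, 0)" "shift (inv g) (u, 1) = (u \<otimes> inv g, 1)"
    using gu by (simp_all add: shift_def)
  then have mem: "(\<one>, 0) \<in> ?B" "(u \<otimes> inv g, 1) \<in> ?B" using gu by force+
  obtain K where K: "subgroup K G" "?B = coset_pair K (u \<otimes> inv g)"
    by (rule block_coset_pair[OF sub shift_block[OF B(1,2) ig] mem])
  have c: "u \<otimes> inv g \<in> carrier G" using gu by simp
  have "out_cut (arcs X) ?B = min (card T\<^sub>0) (card T\<^sub>1)"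
    using action.cut_act(1)[of "shift (inv g)" B] ig B(1,5) by simp
  then show thesis using that[OF K(1) c] out_cut_coset_pair[OF K(1) c] unfolding K(2) by simp
qed

lemma directed_cycle_if_card_1:
  assumes "card T\<^sub>0 = 1" "card T\<^sub>1 = 1"
  shows "directed_cycle X"
proof -
  obtain s t where "T\<^sub>0 = {s}" "T\<^sub>1 = {t}" using assms by (metis card_1_singletonE)
  then have st: "\<And>x. x \<in> T\<^sub>0 \<longleftrightarrow> x = s" "\<And>x. x \<in> T\<^sub>1 \<longleftrightarrow> x = t" by simp_all
  have c: "s \<in> carrier G" "t \<in> carrier G" using st in_T by auto
  define f where "f p = (if snd p = (0::nat) then (s \<otimes> fst p, 1::nat) else (inv t \<otimes> fst p, 0))" for p
  have "arcs X = {(v, f v) | v. v \<in> verts X}"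
  proof
    show "arcs X \<subseteq> {(v, f v) | v. v \<in> verts X}"
    proof
      fix e assume "e \<in> arcs X"
      then show "e \<in> {(v, f v) | v. v \<in> verts X}"
      proof (cases rule: arcs_X_cases)
        case (1 g t')
        then show ?thesis using st by (simp add: f_def X_simps(1))
      next
        case (2 g t')
        then show ?thesis using st c by (simp add: f_def X_simps(1) m_assoc[symmetric])
      qed
    qed
    show "{(v, f v) | v. v \<in> verts X} \<subseteq> arcs X"
    proof
      fix e assume "e \<in> {(v, f v) | v. v \<in> verts X}"
      then obtain v where v: "v \<in> L\<^sub>0 \<union> L\<^sub>1" "e = (v, f v)" unfolding X_simps(1) by blast
      then obtain g where "g \<in> carrier G" "v = (g, 0) \<or> v = (g, 1)" by blast
      then show "e \<in> arcs X"
        using v(2) st arcs_X_iff(1)[of g "s \<otimes> g"] arcs_X_inv(2)[of g t] by (auto simp: f_def)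
    qed
  qed
  moreover have "f ` verts X \<subseteq> verts X"
    unfolding X_simps(1) by (rule image_subsetI) (use c in \<open>auto simp: f_def\<close>)
  ultimately show ?thesis by (rule directed_cycle_functional[OF connected X_simps(2,3)])
qed

end

text \<open>Here \<open>h\<close> is the order of the subgroup and \<open>a\<close>,
  \<open>b\<close> count the elements of \<open>T\<^sub>0\<close>, \<open>T\<^sub>1\<close> outside
  the coset, which holds at most \<open>h\<close> of each. Adding the last two assumptions gives
  \<open>2 * h * (a + b) \<le> 2 * h + (a + b)\<close>, that is
  \<open>(2 * h - 1) * (a + b - 1) \<le> 1\<close>. So \<open>a + b \<ge> 2\<close> leaves only
  \<open>h = 1\<close> and \<open>a + b = 2\<close>.\<close>

lemma coset_size_cases:
  fixes h a b d\<^sub>0 d\<^sub>1 :: nat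
  assumes "h * (a + b) = min d\<^sub>0 d\<^sub>1" "0 < min d\<^sub>0 d\<^sub>1" "d\<^sub>0 \<le> h + a" "d\<^sub>1 \<le> h + b"
  shows "h = min d\<^sub>0 d\<^sub>1 \<and> a + b = 1 \<or> h = 1 \<and> a = 1 \<and> b = 1 \<and> d\<^sub>0 = 2 \<and> d\<^sub>1 = 2"
proof -
  have pos: "0 < h" "0 < a + b" using assms(1,2) by (metis gr0I mult_0 mult_0_right)+
  show ?thesis
  proof (cases "a + b = 1")
    case True
    then show ?thesis using assms(1) by simp
  next
    case False
    define h' k where "h' = h - 1" and "k = a + b - 2"
    have hk: "h = Suc h'" "a + b = Suc (Suc k)" using pos False unfolding h'_def k_def by linarith+
    have "2 * (h * (a + b)) \<le> 2 * h + (a + b)" using assms by linarith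
    then have "4 * h' + 2 * (h' * k) + 4 + 2 * k \<le> 2 * h' + 4 + k"
      unfolding hk by (simp add: algebra_simps)
    then have "h' = 0" "k = 0" by linarith+
    then have "h = 1" "a + b = 2" using hk by auto
    then show ?thesis using assms by auto
  qed
qed

section \<open>The subgroup conditions as statements about one coset\<close>

context connected_bi_cayley
begin

lemma l_coset_subset_iff:
  assumes "c \<in> carrier G" "S \<subseteq> carrier G" "subgroup K G"
  shows "inv c <# S \<subseteq> K \<longleftrightarrow> S \<subseteq> c <# K"
proof -
  have "inv c <# S \<subseteq> K \<longleftrightarrow> (\<forall>s\<in>S. inv c \<otimes> s \<in> K)" unfolding l_coset_def by auto
  then show ?thesis using l_coset_iff[OF assms(1) _ assms(3)] assms(2) by blast
qed

lemma r_coset_inv_subset_iff: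
  assumes "c \<in> carrier G" "S \<subseteq> carrier G" "subgroup K G"
  shows "set_inv S #> c \<subseteq> K \<longleftrightarrow> S \<subseteq> c <# K"
proof -
  have "set_inv S #> c \<subseteq> K \<longleftrightarrow> (\<forall>s\<in>S. inv s \<otimes> c \<in> K)" unfolding r_coset_def SET_INV_def by auto
  then show ?thesis using l_coset_iff'[OF assms(1) _ assms(3)] assms(2) by blast
qed

lemma l_coset_repr:
  assumes "c \<in> carrier G" "t \<in> c <# K" "subgroup K G"
  shows "t <# K = c <# K"
  using l_repr_independence[OF assms(2,1,3)] by simp

lemma self_in_l_coset: "\<lbrakk>c \<in> carrier G; subgroup K G\<rbrakk> \<Longrightarrow> c \<in> c <# K"
  by (simp add: l_coset_iff subgroup.one_closed)

end

theorem theorem3p9: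
  fixes G :: "('a, 'b) monoid_scheme" (structure)
    and T\<^sub>0 T\<^sub>1 :: "'a set"
    and X :: "('a \<times> nat, ('a \<times> nat) \<times> ('a \<times> nat)) pre_digraph"
  assumes "group G" and "finite (carrier G)"
    and "T\<^sub>0 \<subseteq> carrier G" and "T\<^sub>1 \<subseteq> carrier G"
    and "X = bi_cayley_digraph G T\<^sub>0 T\<^sub>1"
    and "strongly_connected X"
    and "\<not> directed_cycle X" and "\<not> symmetric_cycle X"
  shows "\<not> super_arc_connected X \<longleftrightarrow>
    (\<comment> \<open>(1)\<close>
      \<exists>H. subgroup H G \<and>
        (\<comment> \<open>(a)\<close>
          (\<exists>t\<^sub>0 \<in> T\<^sub>0. \<exists>t\<^sub>0' \<in> T\<^sub>0. t\<^sub>0 \<noteq> t\<^sub>0' \<and>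
            card H = min_degree X \<and>
            set_inv T\<^sub>1 #> t\<^sub>0 \<subseteq> H \<and>
            inv t\<^sub>0 <# (T\<^sub>0 - {t\<^sub>0'}) \<subseteq> H \<and>
            inv t\<^sub>0 \<otimes> t\<^sub>0' \<notin> H) \<or>
          \<comment> \<open>(b)\<close>
          (\<exists>t\<^sub>0 \<in> T\<^sub>0. \<exists>t\<^sub>0' \<in> T\<^sub>0. \<exists>t\<^sub>0'' \<in> T\<^sub>0.
            t\<^sub>0 \<noteq> t\<^sub>0' \<and> t\<^sub>0 \<noteq> t\<^sub>0'' \<and> t\<^sub>0' \<noteq> t\<^sub>0'' \<and>
            real (card H) = real (min_degree X) / 2 \<and>
            set_inv T\<^sub>1 #> t\<^sub>0 \<subseteq> H \<and>
            inv t\<^sub>0 <# (T\<^sub>0 - {t\<^sub>0', t\<^sub>0''}) \<subseteq> H \<and>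
            inv t\<^sub>0 \<otimes> t\<^sub>0' \<notin> H \<and> inv t\<^sub>0 \<otimes> t\<^sub>0'' \<notin> H))) \<or>
    (\<comment> \<open>(2)\<close>
      \<exists>H. subgroup H G \<and>
        (\<exists>t\<^sub>1 \<in> T\<^sub>1. \<exists>t\<^sub>1' \<in> T\<^sub>1. \<exists>t\<^sub>0 \<in> T\<^sub>0. t\<^sub>1 \<noteq> t\<^sub>1' \<and>
          (\<comment> \<open>(a)\<close>
            card H = min_degree X \<and>
            inv t\<^sub>0 <# T\<^sub>0 \<subseteq> H \<and>
            set_inv (T\<^sub>1 - {t\<^sub>1'}) #> t\<^sub>0 \<subseteq> H \<and>
            inv t\<^sub>1' \<otimes> t\<^sub>0 \<notin> H \<or>
            \<comment> \<open>(b)\<close>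
            real (card H) = real (min_degree X) / 2 \<and>
            inv t\<^sub>0 <# T\<^sub>0 \<subseteq> H \<and>
            set_inv (T\<^sub>1 - {t\<^sub>1, t\<^sub>1'}) #> t\<^sub>0 \<subseteq> H \<and>
            inv t\<^sub>1 \<otimes> t\<^sub>0 \<notin> H \<and> inv t\<^sub>1' \<otimes> t\<^sub>0 \<notin> H))) \<or>
    (\<comment> \<open>(3)\<close>
      \<exists>H. subgroup H G \<and>
        (\<exists>t\<^sub>0 \<in> T\<^sub>0. \<exists>t\<^sub>0' \<in> T\<^sub>0. \<exists>t\<^sub>1 \<in> T\<^sub>1. t\<^sub>0 \<noteq> t\<^sub>0' \<and>
          real (card H) = real (min_degree X) / 2 \<and>
          inv t\<^sub>0 <# (T\<^sub>0 - {t\<^sub>0'}) \<subseteq> H \<and>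
          inv t\<^sub>0 \<otimes> t\<^sub>0' \<notin> H \<and>
          set_inv (T\<^sub>1 - {t\<^sub>1}) #> t\<^sub>0 \<subseteq> H \<and>
          inv t\<^sub>1 \<otimes> t\<^sub>0 \<notin> H))"
proof -
  interpret group G by (rule assms(1))
  interpret connected_bi_cayley G T\<^sub>0 T\<^sub>1
    by unfold_locales (use assms in simp_all)
  have X: "X = bi_cayley_digraph G T\<^sub>0 T\<^sub>1" by (rule assms(5))
  let ?\<delta> = "min (card T\<^sub>0) (card T\<^sub>1)"
  have \<delta>: "min_degree X = ?\<delta>" unfolding X by (rule min_degree)
  have \<delta>_pos: "0 < ?\<delta>" using T_nonempty finite_T by (simp add: card_gt_0_iff)
  have half: "real (card H) = real ?\<delta> / 2 \<longleftrightarrow> card H * 2 = ?\<delta>" for H :: "'a set"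
    by linarith
  have Tc: "T\<^sub>0 - S \<subseteq> carrier G" "T\<^sub>1 - S \<subseteq> carrier G" for S using T\<^sub>0 T\<^sub>1 by auto
  have cosets: "inv t\<^sub>0 <# T\<^sub>0 \<subseteq> H \<longleftrightarrow> T\<^sub>0 \<subseteq> t\<^sub>0 <# H"
    "inv t\<^sub>0 <# (T\<^sub>0 - S) \<subseteq> H \<longleftrightarrow> T\<^sub>0 - S \<subseteq> t\<^sub>0 <# H"
    "set_inv T\<^sub>1 #> t\<^sub>0 \<subseteq> H \<longleftrightarrow> T\<^sub>1 \<subseteq> t\<^sub>0 <# H"
    "set_inv (T\<^sub>1 - S) #> t\<^sub>0 \<subseteq> H \<longleftrightarrow> T\<^sub>1 - S \<subseteq> t\<^sub>0 <# H"
    if "subgroup H G" "t\<^sub>0 \<in> T\<^sub>0" for H t\<^sub>0 S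
    using l_coset_subset_iff[OF in_T(1)[OF that(2)] _ that(1)]
      r_coset_inv_subset_iff[OF in_T(1)[OF that(2)] _ that(1)] T\<^sub>0 T\<^sub>1 Tc by simp_all
  have mem: "inv t\<^sub>0 \<otimes> t \<in> H \<longleftrightarrow> t \<in> t\<^sub>0 <# H" if "subgroup H G" "t\<^sub>0 \<in> T\<^sub>0" "t \<in> T\<^sub>0" for H t\<^sub>0 t
    using l_coset_iff[OF in_T(1) in_T(1), OF that(2,3,1)] by simp
  have mem': "inv t \<otimes> t\<^sub>0 \<in> H \<longleftrightarrow> t \<in> t\<^sub>0 <# H" if "subgroup H G" "t\<^sub>0 \<in> T\<^sub>0" "t \<in> T\<^sub>1" for H t\<^sub>0 t
    using l_coset_iff'[OF in_T(1) in_T(2), OF that(2,3,1)] by simp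

  \<comment> \<open>Each condition says which elements of \<open>T\<^sub>0\<close> and
    \<open>T\<^sub>1\<close> lie outside the coset of \<open>t\<^sub>0\<close>, the data that enter
    the cut formula.\<close>
  have one_a: "(set_inv T\<^sub>1 #> t\<^sub>0 \<subseteq> H \<and> inv t\<^sub>0 <# (T\<^sub>0 - {t\<^sub>0'}) \<subseteq> H \<and> inv t\<^sub>0 \<otimes> t\<^sub>0' \<notin> H) \<longleftrightarrow>
      T\<^sub>1 - (t\<^sub>0 <# H) = {} \<and> T\<^sub>0 - (t\<^sub>0 <# H) = {t\<^sub>0'}"
    if "subgroup H G" "t\<^sub>0 \<in> T\<^sub>0" "t\<^sub>0' \<in> T\<^sub>0" for H t\<^sub>0 t\<^sub>0'
    unfolding cosets[OF that(1,2)] mem[OF that(1,2,3)] using that by blast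
  have one_b: "(set_inv T\<^sub>1 #> t\<^sub>0 \<subseteq> H \<and> inv t\<^sub>0 <# (T\<^sub>0 - {t\<^sub>0', t\<^sub>0''}) \<subseteq> H \<and>
        inv t\<^sub>0 \<otimes> t\<^sub>0' \<notin> H \<and> inv t\<^sub>0 \<otimes> t\<^sub>0'' \<notin> H) \<longleftrightarrow>
      T\<^sub>1 - (t\<^sub>0 <# H) = {} \<and> T\<^sub>0 - (t\<^sub>0 <# H) = {t\<^sub>0', t\<^sub>0''}"
    if "subgroup H G" "t\<^sub>0 \<in> T\<^sub>0" "t\<^sub>0' \<in> T\<^sub>0" "t\<^sub>0'' \<in> T\<^sub>0" for H t\<^sub>0 t\<^sub>0' t\<^sub>0''
    unfolding cosets[OF that(1,2)] mem[OF that(1,2,3)] mem[OF that(1,2,4)] using that by blast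
  have two_a: "(inv t\<^sub>0 <# T\<^sub>0 \<subseteq> H \<and> set_inv (T\<^sub>1 - {t\<^sub>1'}) #> t\<^sub>0 \<subseteq> H \<and> inv t\<^sub>1' \<otimes> t\<^sub>0 \<notin> H) \<longleftrightarrow>
      T\<^sub>0 - (t\<^sub>0 <# H) = {} \<and> T\<^sub>1 - (t\<^sub>0 <# H) = {t\<^sub>1'}"
    if "subgroup H G" "t\<^sub>0 \<in> T\<^sub>0" "t\<^sub>1' \<in> T\<^sub>1" for H t\<^sub>0 t\<^sub>1'
    unfolding cosets[OF that(1,2)] mem'[OF that(1,2,3)] using that by blast
  have three: "(inv t\<^sub>0 <# (T\<^sub>0 - {t\<^sub>0'}) \<subseteq> H \<and> inv t\<^sub>0 \<otimes> t\<^sub>0' \<notin> H \<and>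
        set_inv (T\<^sub>1 - {t\<^sub>1}) #> t\<^sub>0 \<subseteq> H \<and> inv t\<^sub>1 \<otimes> t\<^sub>0 \<notin> H) \<longleftrightarrow>
      T\<^sub>0 - (t\<^sub>0 <# H) = {t\<^sub>0'} \<and> T\<^sub>1 - (t\<^sub>0 <# H) = {t\<^sub>1}"
    if "subgroup H G" "t\<^sub>0 \<in> T\<^sub>0" "t\<^sub>0' \<in> T\<^sub>0" "t\<^sub>1 \<in> T\<^sub>1" for H t\<^sub>0 t\<^sub>0' t\<^sub>1
    unfolding cosets[OF that(1,2)] mem[OF that(1,2,3)] mem'[OF that(1,2,4)] using that by blast

  \<comment> \<open>\<open>T\<^sub>0\<close> meets the coset in \<open>t\<^sub>0\<close> itself, so
    only \<open>T\<^sub>1\<close> remains to be checked.\<close>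
  have notsuper: "\<not> super_arc_connected X"
    if "subgroup H G" "t\<^sub>0 \<in> T\<^sub>0" "T\<^sub>1 \<inter> (t\<^sub>0 <# H) \<noteq> {}"
      "card H * (card (T\<^sub>0 - (t\<^sub>0 <# H)) + card (T\<^sub>1 - (t\<^sub>0 <# H))) = ?\<delta>" for H t\<^sub>0
    unfolding X using that in_T self_in_l_coset by (intro not_super_coset_pair) auto

  show ?thesis (is "_ \<longleftrightarrow> ?c1 \<or> ?c2 \<or> ?c3")
  proof
    assume "\<not> super_arc_connected X"
    then obtain K c where K: "subgroup K G" "c \<in> carrier G"
      and size: "card K * (card (T\<^sub>0 - (c <# K)) + card (T\<^sub>1 - (c <# K))) = ?\<delta>"
      unfolding X by (rule not_super_cosets)
    have finK: "finite (c <# K)" "card (c <# K) = card K"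
      using finite_K(2)[OF K] card_coset[OF K] by auto
    have split: "card T = card (T \<inter> (c <# K)) + card (T - (c <# K))" if "finite T" for T
      using card_Int_Diff[OF that] .
    have int: "card (T \<inter> (c <# K)) \<le> card K" for T
      using card_mono[OF finK(1), of "T \<inter> (c <# K)"] finK(2) by simp
    have le: "card T\<^sub>0 \<le> card K + card (T\<^sub>0 - (c <# K))" "card T\<^sub>1 \<le> card K + card (T\<^sub>1 - (c <# K))"
      using split[OF finite_T(1)] split[OF finite_T(2)] int by (metis add_le_mono1)+
    have not_1: "\<not> (card T\<^sub>0 = 1 \<and> card T\<^sub>1 = 1)"
      using directed_cycle_if_card_1 assms(7) unfolding X by blast
    from coset_size_cases[OF size \<delta>_pos le] consider
        "card K = ?\<delta>" "card (T\<^sub>0 - (c <# K)) = 1" "card (T\<^sub>1 - (c <# K)) = 0"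
      | "card K = ?\<delta>" "card (T\<^sub>0 - (c <# K)) = 0" "card (T\<^sub>1 - (c <# K)) = 1"
      | "card K = 1" "card (T\<^sub>0 - (c <# K)) = 1" "card (T\<^sub>1 - (c <# K)) = 1" "card T\<^sub>0 = 2" "card T\<^sub>1 = 2"
      by linarith
    then show "?c1 \<or> ?c2 \<or> ?c3"
    proof cases
      case 1
      then obtain t\<^sub>0' where t0': "T\<^sub>0 - (c <# K) = {t\<^sub>0'}" by (metis card_1_singletonE)
      \<comment> \<open>If \<open>T\<^sub>0\<close> missed the coset, it would have one element, so
        \<delta> and \<open>card K\<close> would be 1; as the coset contains
        \<open>T\<^sub>1\<close>, also \<open>card T\<^sub>1 = 1\<close>, the excluded directed
        cycle.\<close>
      have "card (T\<^sub>0 \<inter> (c <# K)) \<noteq> 0"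
        using split[OF finite_T(1)] 1 not_1 le(2) \<delta>_pos by linarith
      then obtain t\<^sub>0 where t0: "t\<^sub>0 \<in> T\<^sub>0" "t\<^sub>0 \<in> c <# K" by (metis IntE card.empty ex_in_conv)
      \<comment> \<open>The conditions name the coset by an element of \<open>T\<^sub>0\<close>, so
        \<open>t\<^sub>0\<close> replaces \<open>c\<close>.\<close>
      have eq: "t\<^sub>0 <# K = c <# K" using l_coset_repr[OF K(2) t0(2) K(1)] .
      have "T\<^sub>1 - (t\<^sub>0 <# K) = {}" "T\<^sub>0 - (t\<^sub>0 <# K) = {t\<^sub>0'}" "t\<^sub>0' \<in> T\<^sub>0" "t\<^sub>0 \<noteq> t\<^sub>0'"
        using 1(3) t0' t0 finite_T unfolding eq by auto
      then show ?thesis using one_a[OF K(1) t0(1)] K(1) t0(1) 1(1) \<delta> by metis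
    next
      case 2
      then obtain t\<^sub>1' where t1': "T\<^sub>1 - (c <# K) = {t\<^sub>1'}" by (metis card_1_singletonE)
      have "card (T\<^sub>1 \<inter> (c <# K)) \<noteq> 0"
        using split[OF finite_T(2)] 2 not_1 le(1) \<delta>_pos by linarith
      then obtain t\<^sub>1 where t1: "t\<^sub>1 \<in> T\<^sub>1" "t\<^sub>1 \<in> c <# K" by (metis IntE card.empty ex_in_conv)
      obtain t\<^sub>0 where t0: "t\<^sub>0 \<in> T\<^sub>0" "t\<^sub>0 \<in> c <# K" using 2(2) T_nonempty finite_T by auto
      have eq: "t\<^sub>0 <# K = c <# K" using l_coset_repr[OF K(2) t0(2) K(1)] .
      have "T\<^sub>0 - (t\<^sub>0 <# K) = {}" "T\<^sub>1 - (t\<^sub>0 <# K) = {t\<^sub>1'}" "t\<^sub>1' \<in> T\<^sub>1" "t\<^sub>1 \<noteq> t\<^sub>1'"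
        using 2(2) t1' t1 finite_T unfolding eq by auto
      then show ?thesis using two_a[OF K(1) t0(1)] K(1) t0(1) t1(1) 2(1) \<delta> by metis
    next
      case 3
      then obtain t\<^sub>0' where t0': "T\<^sub>0 - (c <# K) = {t\<^sub>0'}" by (metis card_1_singletonE)
      obtain t\<^sub>1 where t1: "T\<^sub>1 - (c <# K) = {t\<^sub>1}" using 3 by (metis card_1_singletonE)
      have "card (T\<^sub>0 \<inter> (c <# K)) \<noteq> 0" using split[OF finite_T(1)] 3 by linarith
      then obtain t\<^sub>0 where t0: "t\<^sub>0 \<in> T\<^sub>0" "t\<^sub>0 \<in> c <# K" by (metis IntE card.empty ex_in_conv)
      have eq: "t\<^sub>0 <# K = c <# K" using l_coset_repr[OF K(2) t0(2) K(1)] .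
      have *: "T\<^sub>0 - (t\<^sub>0 <# K) = {t\<^sub>0'}" "T\<^sub>1 - (t\<^sub>0 <# K) = {t\<^sub>1}" "t\<^sub>0' \<in> T\<^sub>0" "t\<^sub>1 \<in> T\<^sub>1" "t\<^sub>0 \<noteq> t\<^sub>0'"
        using t0' t1 t0 unfolding eq by auto
      \<comment> \<open>The trivial subgroup with \<delta> equal to 2 is the instance of
        \<open>card H = \<delta> / 2\<close> that arises.\<close>
      have "card K * 2 = ?\<delta>" using 3 by simp
      then have "real (card K) = real (min_degree X) / 2" unfolding \<delta> half .
      then show ?thesis using three[OF K(1) t0(1) *(3,4)] K(1) t0(1) * by metis
    qed
  next
    assume "?c1 \<or> ?c2 \<or> ?c3"
    then show "\<not> super_arc_connected X"
    proof (elim disjE)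
      \<comment> \<open>The order of \<open>H\<close> times the number of elements outside the coset
        is \<delta>, either with order \<delta> and one element or with order
        \<open>\<delta> / 2\<close> and two.\<close>
      assume ?c1
      then show ?thesis
      proof (elim exE conjE disjE bexE)
        fix H t\<^sub>0 t\<^sub>0'
        assume H: "subgroup H G" "t\<^sub>0 \<in> T\<^sub>0" "t\<^sub>0' \<in> T\<^sub>0" "card H = min_degree X"
          "set_inv T\<^sub>1 #> t\<^sub>0 \<subseteq> H" "inv t\<^sub>0 <# (T\<^sub>0 - {t\<^sub>0'}) \<subseteq> H" "inv t\<^sub>0 \<otimes> t\<^sub>0' \<notin> H"
        then have *: "T\<^sub>1 - (t\<^sub>0 <# H) = {}" "T\<^sub>0 - (t\<^sub>0 <# H) = {t\<^sub>0'}" using one_a[OF H(1-3)] by blast+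
        have "T\<^sub>1 \<inter> (t\<^sub>0 <# H) \<noteq> {}" using T_nonempty(2) *(1) by blast
        then show ?thesis by (rule notsuper[OF H(1,2)]) (simp add: * H(4) \<delta>)
      next
        fix H t\<^sub>0 t\<^sub>0' t\<^sub>0''
        assume H: "subgroup H G" "t\<^sub>0 \<in> T\<^sub>0" "t\<^sub>0' \<in> T\<^sub>0" "t\<^sub>0'' \<in> T\<^sub>0"
          "real (card H) = real (min_degree X) / 2" "t\<^sub>0' \<noteq> t\<^sub>0''"
          "set_inv T\<^sub>1 #> t\<^sub>0 \<subseteq> H" "inv t\<^sub>0 <# (T\<^sub>0 - {t\<^sub>0', t\<^sub>0''}) \<subseteq> H"
          "inv t\<^sub>0 \<otimes> t\<^sub>0' \<notin> H" "inv t\<^sub>0 \<otimes> t\<^sub>0'' \<notin> H"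
        then have *: "T\<^sub>1 - (t\<^sub>0 <# H) = {}" "T\<^sub>0 - (t\<^sub>0 <# H) = {t\<^sub>0', t\<^sub>0''}"
          using one_b[OF H(1-4)] by blast+
        have h: "card H * 2 = ?\<delta>" using H(5) unfolding \<delta> half .
        have "T\<^sub>1 \<inter> (t\<^sub>0 <# H) \<noteq> {}" using T_nonempty(2) *(1) by blast
        then show ?thesis by (rule notsuper[OF H(1,2)]) (simp add: * H(6) h[symmetric])
      qed
    next
      assume ?c2
      then show ?thesis
      proof (elim exE conjE disjE bexE)
        fix H t\<^sub>1 t\<^sub>1' t\<^sub>0
        assume H: "subgroup H G" "t\<^sub>0 \<in> T\<^sub>0" "t\<^sub>1' \<in> T\<^sub>1" "t\<^sub>1 \<in> T\<^sub>1" "t\<^sub>1 \<noteq> t\<^sub>1'" "card H = min_degree X"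
          "inv t\<^sub>0 <# T\<^sub>0 \<subseteq> H" "set_inv (T\<^sub>1 - {t\<^sub>1'}) #> t\<^sub>0 \<subseteq> H" "inv t\<^sub>1' \<otimes> t\<^sub>0 \<notin> H"
        then have *: "T\<^sub>0 - (t\<^sub>0 <# H) = {}" "T\<^sub>1 - (t\<^sub>0 <# H) = {t\<^sub>1'}" using two_a[OF H(1-3)] by blast+
        have "T\<^sub>1 \<inter> (t\<^sub>0 <# H) \<noteq> {}" using H(4,5) *(2) by blast
        then show ?thesis by (rule notsuper[OF H(1,2)]) (simp add: * H(6) \<delta>)
      next
        fix H t\<^sub>1 t\<^sub>1' t\<^sub>0
        assume H: "subgroup H G" "t\<^sub>0 \<in> T\<^sub>0" "real (card H) = real (min_degree X) / 2"
          "inv t\<^sub>0 <# T\<^sub>0 \<subseteq> H"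
        have t0: "t\<^sub>0 \<in> carrier G" using H(2) in_T by blast
        \<comment> \<open>Both named elements of \<open>T\<^sub>1\<close> lie outside the coset, so
          none inside is supplied. The case is refuted by size instead: \<open>T\<^sub>0\<close> has
          at least \<delta> elements and does not fit into a coset of size
          \<open>\<delta> / 2\<close>.\<close>
        have "T\<^sub>0 \<subseteq> t\<^sub>0 <# H" using H(4) l_coset_subset_iff[OF t0 T\<^sub>0 H(1)] by blast
        then have "card T\<^sub>0 \<le> card H"
          using card_mono[OF finite_K(2)[OF H(1) t0]] card_coset[OF H(1) t0] by simp
        moreover have "card H * 2 = ?\<delta>" using H(3) unfolding \<delta> half .
        ultimately show ?thesis using \<delta>_pos by linarith
      qed
    next
      assume ?c3
      then show ?thesis
      proof (elim exE conjE bexE)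
        fix H t\<^sub>0 t\<^sub>0' t\<^sub>1
        assume H: "subgroup H G" "t\<^sub>0 \<in> T\<^sub>0" "t\<^sub>0' \<in> T\<^sub>0" "t\<^sub>1 \<in> T\<^sub>1"
          "real (card H) = real (min_degree X) / 2"
          "inv t\<^sub>0 <# (T\<^sub>0 - {t\<^sub>0'}) \<subseteq> H" "inv t\<^sub>0 \<otimes> t\<^sub>0' \<notin> H"
          "set_inv (T\<^sub>1 - {t\<^sub>1}) #> t\<^sub>0 \<subseteq> H" "inv t\<^sub>1 \<otimes> t\<^sub>0 \<notin> H"
        then have *: "T\<^sub>0 - (t\<^sub>0 <# H) = {t\<^sub>0'}" "T\<^sub>1 - (t\<^sub>0 <# H) = {t\<^sub>1}"
          using three[OF H(1-4)] by blast+
        have h: "card H * 2 = ?\<delta>" using H(5) unfolding \<delta> half .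
        \<comment> \<open>Otherwise \<open>T\<^sub>1\<close> is a singleton and \<delta> at most 1,
          while \<delta> is even and positive.\<close>
        have "T\<^sub>1 \<inter> (t\<^sub>0 <# H) \<noteq> {}"
        proof
          assume "T\<^sub>1 \<inter> (t\<^sub>0 <# H) = {}"
          then have "T\<^sub>1 = {t\<^sub>1}" using *(2) by blast
          then have "card T\<^sub>1 = 1" by simp
          then have "card H * 2 \<le> 1" using h by simp
          then have "card H = 0" by simp
          then show False using h \<delta>_pos by simp
        qed
        then show ?thesis by (rule notsuper[OF H(1,2)]) (simp add: * h[symmetric])
      qed
    qed
  qed
qed

end
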